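(* Let $p \in (1,\infty)$. Let $\mathcal{F}$ be a non-empty subset of $\mathcal{P}_p(\mathbb{R})$ which is displacement convex and closed with respect to $\mathcal{W}_p$. Then there exists a mapping $\mathrm{proj}_{\mathcal{F}}^{(p)} : \mathcal{P}_p(\mathbb{R}) \to \mathcal{F}$ such that for every $\mu \in \mathcal{P}_p(\mathbb{R})$, $\mathrm{proj}_{\mathcal{F}}^{(p)}\mu$ is the unique minimizer of the projection problem $$\inf_{\nu \in \mathcal{F}} \mathcal{W}_p(\nu,\mu).$$ Moreover, when $p = 2$, $\mathrm{proj}_{\mathcal{F}} := \mathrm{proj}_{\mathcal{F}}^{(2)}$ is $1$-Lipschitz, that is, $$\mathcal{W}_2(\mathrm{proj}_{\mathcal{F}}\mu, \mathrm{proj}_{\mathcal{F}}\nu) \le \mathcal{W}_2(\mu,\nu), \quad \mu,\nu \in \mathcal{P}_2(\mathbb{R}).$$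
   Context: $\mathcal{P}_p(\mathbb{R})$ is the set of Borel probability measures on $\mathbb{R}$ with finite $p$-th moment. The $p$-Wasserstein distance is $\mathcal{W}_p(\mu,\nu) = \left(\inf_{\pi} \int |x-y|^p\,d\pi(x,y)\right)^{1/p}$, the infimum being over all couplings $\pi$ of $\mu$ and $\nu$ (probability measures on $\mathbb{R}\times\mathbb{R}$ with first marginal $\mu$ and second marginal $\nu$). The quantile function of a Borel probability measure $\mu$ on $\mathbb{R}$ is $Q_\mu(u) = \inf\{x : \mu((-\infty,x]) \ge u\}$, $u \in (0,1)$. A set $\mathcal{F}$ of Borel probability measures on $\mathbb{R}$ is called displacement convex if the set $\{Q_\mu : \mu \in \mathcal{F}\}$ of its quantile functions is convex in the usual sense. *)

theory Defs
  imports "HOL-Probability.Probability"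
begin

text \<open>Borel probability measures on the real line are the measures satisfying the library
  predicate \<open>real_distribution\<close>: probability measures whose sigma-algebra is exactly the Borel one.\<close>

definition finite_moment_measures :: "real \<Rightarrow> real measure set" where
  "finite_moment_measures p =
     {\<mu>. real_distribution \<mu> \<and> integrable \<mu> (\<lambda>x. \<bar>x\<bar> powr p)}"

definition couplings :: "real measure \<Rightarrow> real measure \<Rightarrow> (real \<times> real) measure set" where
  "couplings \<mu> \<nu> =
     {\<pi>. prob_space \<pi> \<and> sets \<pi> = sets borel \<and>
          distr \<pi> borel fst = \<mu> \<and> distr \<pi> borel snd = \<nu>}"

text \<open>The infimum is taken in \<open>[0, \<infinity>]\<close>. It is finite for measures with finite \<open>p\<close>-th moment;
  an infinite value would be sent to \<open>0\<close> by \<^const>\<open>enn2real\<close>, so the definition is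
  meaningful only on \<open>finite_moment_measures p\<close>.\<close>

definition wasserstein :: "real \<Rightarrow> real measure \<Rightarrow> real measure \<Rightarrow> real" where
  "wasserstein p \<mu> \<nu> =
     enn2real (INF \<pi>\<in>couplings \<mu> \<nu>. \<integral>\<^sup>+ (x, y). ennreal (\<bar>x - y\<bar> powr p) \<partial>\<pi>) powr (1 / p)"

text \<open>Quantile functions have domain \<open>(0, 1)\<close>, so they are made extensional by
  \<^const>\<open>restrict\<close>: equality of such functions is equality on \<open>(0, 1)\<close>.\<close>

definition quantile :: "real measure \<Rightarrow> real \<Rightarrow> real" where
  "quantile \<mu> = (\<lambda>u\<in>{0<..<1}. Inf {x. u \<le> cdf \<mu> x})"

text \<open>The function type is no instance of \<^class>\<open>real_vector\<close>, so the definition of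
  \<^const>\<open>convex\<close> is spelled out for functions on \<open>(0, 1)\<close>.\<close>

definition displacement_convex :: "real measure set \<Rightarrow> bool" where
  "displacement_convex F \<longleftrightarrow>
     (\<forall>f\<in>quantile ` F. \<forall>g\<in>quantile ` F. \<forall>s\<ge>0. \<forall>t\<ge>0. s + t = 1 \<longrightarrow>
        (\<lambda>u\<in>{0<..<1}. s * f u + t * g u) \<in> quantile ` F)"

text \<open>The topology which the metric \<open>wasserstein p\<close> induces on \<open>finite_moment_measures p\<close>.\<close>

abbreviation wasserstein_topology :: "real \<Rightarrow> real measure topology" where
  "wasserstein_topology p \<equiv> Metric_space.mtopology (finite_moment_measures p) (wasserstein p)"

end

theory Submission
  imports Defs
begin

text \<open>The quantile coupling is optimal: writing \<open>\<bar>x - y\<bar> powr p\<close> as a mixture of the indicators of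
  \<open>{y \<le> t - s, t < x}\<close> and \<open>{x \<le> t - s, t < y}\<close>, the mass that a coupling gives to each of these
  sets is bounded below in terms of the two distribution functions, and the quantile coupling
  attains all these bounds at once. Hence \<open>wasserstein p\<close> is the \<open>L\<^sup>p\<close> distance of quantile
  functions on \<open>(0, 1)\<close>, and the theorem becomes the statement about nearest points of closed convex
  sets in a uniformly convex space: by uniform convexity minimizing sequences are Cauchy and
  minimizers are unique. For \<open>p = 2\<close> the nearest point is characterised by obtuse angles, which
  gives nonexpansiveness as in any Hilbert space.\<close>

section \<open>Optimality of the quantile coupling\<close>

text \<open>The mixture that represents the cost has density p(p-1)s^(p-2), which for p > 1 is
  positive and integrable near 0. It turns optimality into a comparison of quadrant masses, with no
  duality and no separate existence theorem for optimal couplings. The delicate point of the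
  transfer to L^p would be to show that a limit of quantile functions is again, up to a null set, a
  quantile function. This is bypassed: the limit measure is the law of the limit function, and
  pairing each quantile function with that limit function is some coupling, which suffices to bound
  the distance from above. Closedness of \<open>F\<close> is thus used directly in the Wasserstein
  metric, and displacement convexity places the midpoints in \<open>F\<close>, so no convex
  combination has to be recognised as a quantile function by hand. For p = 1 the midpoint inequality
  is not strict for numbers of equal sign, and the convexity argument breaks down.\<close>

abbreviation unit_measure :: "real measure" where
  "unit_measure \<equiv> restrict_space lborel {0<..<1}"

lemma prob_space_unit_measure: "prob_space unit_measure"
  by (auto simp: space_restrict_space emeasure_restrict_space intro!: prob_spaceI)

text \<open>Right continuity of the distribution function makes the infimum attained, which gives
  this Galois connection. Through it, events about quantile functions become intervals in
  \<open>u\<close>.\<close>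

lemma quantile_le_iff:
  assumes "real_distribution \<mu>" and "0 < u" "u < 1"
  shows "quantile \<mu> u \<le> x \<longleftrightarrow> u \<le> cdf \<mu> x"
proof -
  interpret cdf_distribution \<mu>
    using assms(1) by (simp add: cdf_distribution_def)
  show ?thesis
    using pseudoinverse[of u x] assms(2,3) by (simp add: quantile_def)
qed

lemma measurable_quantile:
  assumes "real_distribution \<mu>"
  shows "quantile \<mu> \<in> borel_measurable unit_measure"
proof -
  interpret cdf_distribution \<mu>
    using assms by (simp add: cdf_distribution_def)
  have "I \<in> borel_measurable unit_measure"
    using measurable_CI by (simp add: measurable_def space_restrict_space sets_restrict_space)
  then show ?thesis
    by (rule measurable_cong[THEN iffD1, rotated]) (simp add: quantile_def space_restrict_space)
qed

text \<open>Inverse transform sampling. It also shows that a measure is determined by its quantile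
  function up to null sets.\<close>

lemma distr_quantile:
  assumes "real_distribution \<mu>"
  shows "distr unit_measure borel (quantile \<mu>) = \<mu>"
proof -
  interpret cdf_distribution \<mu>
    using assms by (simp add: cdf_distribution_def)
  have "distr unit_measure borel (quantile \<mu>) = distr unit_measure borel I"
    by (intro distr_cong) (auto simp: quantile_def space_restrict_space)
  then show ?thesis
    by (simp add: distr_I_eq_M)
qed

section \<open>Layer-cake formula for the transport cost\<close>

definition layer_weight :: "real \<Rightarrow> real \<Rightarrow> ennreal" where
  "layer_weight p s = ennreal (p * (p - 1) * s powr (p - 2)) * indicator {0<..} s"

lemma measurable_layer_weight [measurable]: "layer_weight p \<in> borel_measurable borel"
  unfolding layer_weight_def by measurable

text \<open>Taylor's formula at 0 with integral remainder, for the p-th power. The truncation by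
  \<open>ennreal (a - s)\<close> ends the integral at \<open>a\<close>, and the indicator in the
  weight starts it at 0.\<close>

lemma nn_integral_layer_weight:
  fixes a p :: real
  assumes p: "1 < p"
  shows "(\<integral>\<^sup>+ s. layer_weight p s * ennreal (a - s) \<partial>lborel) = ennreal (max a 0 powr p)"
proof (cases "0 < a")
  case True
  \<comment> \<open>An explicit antiderivative of the integrand. For p < 2 it is not differentiable
    at 0, hence the version of the fundamental theorem with derivatives in the interior
    only.\<close>
  define F where "F s = p * a * s powr (p - 1) - (p - 1) * s powr p" for s :: real
  have "((\<lambda>s. p * (p - 1) * s powr (p - 2) * (a - s)) has_integral (F a - F 0)) {0..a}"
  proof (rule fundamental_theorem_of_calculus_interior)
    show "continuous_on {0..a} F"
      unfolding F_def using p by (intro continuous_intros continuous_on_powr') auto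
    show "(F has_vector_derivative p * (p - 1) * s powr (p - 2) * (a - s)) (at s)"
      if s: "s \<in> {0<..<a}" for s
    proof -
      have "s powr (p - 1) = s * s powr (p - 2)"
        using s powr_mult_base[of s "p - 2"] by (simp add: algebra_simps)
      moreover have "(F has_real_derivative
          p * a * ((p - 1) * s powr (p - 1 - 1)) - (p - 1) * (p * s powr (p - 1))) (at s)"
        unfolding F_def using s by (auto intro!: derivative_eq_intros)
      moreover have "p - 1 - 1 = p - 2"
        by simp
      ultimately show ?thesis
        by (simp add: has_real_derivative_iff_has_vector_derivative[symmetric] algebra_simps)
    qed
  qed (use True in auto)
  then have "(\<integral>\<^sup>+ s. ennreal (p * (p - 1) * s powr (p - 2) * (a - s)) * indicator {0..a} s \<partial>lborel)
      = ennreal (F a - F 0)"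
    using p by (intro nn_integral_has_integral_lebesgue') auto
  also have "F a - F 0 = a powr p"
    using True p powr_mult_base[of a "p - 1"] by (simp add: F_def algebra_simps)
  also have "(\<integral>\<^sup>+ s. ennreal (p * (p - 1) * s powr (p - 2) * (a - s)) * indicator {0..a} s \<partial>lborel)
      = (\<integral>\<^sup>+ s. layer_weight p s * ennreal (a - s) \<partial>lborel)"
    using p by (intro nn_integral_cong)
      (auto simp: layer_weight_def indicator_def ennreal_mult' ennreal_neg)
  finally show ?thesis
    using True by simp
next
  case False
  then have "(\<lambda>s. layer_weight p s * ennreal (a - s)) = (\<lambda>s. 0)"
    by (auto simp: layer_weight_def indicator_def ennreal_neg)
  with False show ?thesis
    by (simp only:) simp
qed

text \<open>The inner integrals are \<open>(x - y - s)\<^sup>+\<close> and \<open>(y - x - s)\<^sup>+\<close>, and \<open>layer_weight p\<close> is the second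
  derivative of \<open>s powr p\<close>.\<close>

lemma powr_layer_cake:
  fixes x y p :: real
  assumes "1 < p"
  shows "(\<integral>\<^sup>+ s. \<integral>\<^sup>+ t. layer_weight p s * ((if y \<le> t - s \<and> t < x then 1 else 0) +
           (if x \<le> t - s \<and> t < y then 1 else 0)) \<partial>lborel \<partial>lborel) = ennreal (\<bar>x - y\<bar> powr p)"
proof -
  have len: "(\<integral>\<^sup>+ t. (if b \<le> t - s \<and> t < a then 1 else 0) \<partial>lborel) = ennreal (a - b - s)"
    for a b s :: real
  proof -
    have "(\<integral>\<^sup>+ t. (if b \<le> t - s \<and> t < a then 1 else 0) \<partial>lborel)
        = (\<integral>\<^sup>+ t. indicator {b + s..<a} t \<partial>lborel)"
      by (intro nn_integral_cong) (auto simp: indicator_def)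
    also have "\<dots> = ennreal (a - b - s)"
      by (cases "b + s \<le> a") (auto simp: ennreal_neg algebra_simps)
    finally show ?thesis .
  qed
  have "(\<integral>\<^sup>+ s. \<integral>\<^sup>+ t. layer_weight p s * ((if y \<le> t - s \<and> t < x then 1 else 0) +
           (if x \<le> t - s \<and> t < y then 1 else 0)) \<partial>lborel \<partial>lborel)
      = (\<integral>\<^sup>+ s. layer_weight p s * ennreal (x - y - s) + layer_weight p s * ennreal (y - x - s) \<partial>lborel)"
    by (intro nn_integral_cong)
      (simp add: nn_integral_cmult nn_integral_add len distrib_left)
  also have "\<dots> = ennreal (max (x - y) 0 powr p) + ennreal (max (y - x) 0 powr p)"
    by (simp add: nn_integral_add nn_integral_layer_weight[OF assms])
  also have "\<dots> = ennreal (\<bar>x - y\<bar> powr p)"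
    by (auto simp: max_def)
  finally show ?thesis .
qed

text \<open>Tonelli's theorem moves the integral over \<pi> innermost, so that the coupling enters
  only through masses of quadrants. The identity holds in [0,\<infinity>] without moment assumptions
  and therefore applies to every coupling.\<close>

lemma coupling_cost_eq:
  fixes \<pi> :: "(real \<times> real) measure"
  assumes "prob_space \<pi>" and sets[measurable_cong]: "sets \<pi> = sets borel" and p: "1 < p"
  shows "(\<integral>\<^sup>+ (x, y). ennreal (\<bar>x - y\<bar> powr p) \<partial>\<pi>) =
    (\<integral>\<^sup>+ s. \<integral>\<^sup>+ t. layer_weight p s *
       (emeasure \<pi> {z. snd z \<le> t - s \<and> t < fst z} + emeasure \<pi> {z. fst z \<le> t - s \<and> t < snd z})
     \<partial>lborel \<partial>lborel)"
proof -
  interpret prob_space \<pi> by fact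
  interpret P: pair_sigma_finite \<pi> lborel ..
  have [measurable]: "fst \<in> borel_measurable \<pi>" "snd \<in> borel_measurable \<pi>"
    by (simp_all add: borel_prod[symmetric] measurable_cong_sets[OF sets refl])
  let ?k = "\<lambda>z s t. layer_weight p s * ((if snd z \<le> t - s \<and> t < fst z then 1 else 0) +
           (if fst z \<le> t - s \<and> t < snd z then 1 else 0)) :: ennreal"
  have "(\<integral>\<^sup>+ (x, y). ennreal (\<bar>x - y\<bar> powr p) \<partial>\<pi>) =
      (\<integral>\<^sup>+ z. \<integral>\<^sup>+ s. \<integral>\<^sup>+ t. ?k z s t \<partial>lborel \<partial>lborel \<partial>\<pi>)"
    by (simp add: powr_layer_cake[OF p] case_prod_beta')
  also have "\<dots> = (\<integral>\<^sup>+ s. \<integral>\<^sup>+ z. \<integral>\<^sup>+ t. ?k z s t \<partial>lborel \<partial>\<pi> \<partial>lborel)"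
    by (intro P.Fubini'[symmetric]) measurable
  also have "\<dots> = (\<integral>\<^sup>+ s. \<integral>\<^sup>+ t. \<integral>\<^sup>+ z. ?k z s t \<partial>\<pi> \<partial>lborel \<partial>lborel)"
    by (intro nn_integral_cong P.Fubini'[symmetric]) measurable
  also have "\<dots> = (\<integral>\<^sup>+ s. \<integral>\<^sup>+ t. layer_weight p s *
       (emeasure \<pi> {z. snd z \<le> t - s \<and> t < fst z} + emeasure \<pi> {z. fst z \<le> t - s \<and> t < snd z})
     \<partial>lborel \<partial>lborel)"
  proof (intro nn_integral_cong)
    fix s t :: real
    have space: "space \<pi> = UNIV"
      using sets_eq_imp_space_eq[OF sets] by simp
    have *: "(\<integral>\<^sup>+ z. (if P z then 1 else 0) \<partial>\<pi>) = emeasure \<pi> {z. P z}"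
      if [measurable]: "Measurable.pred \<pi> P" for P
    proof -
      have "(\<integral>\<^sup>+ z. (if P z then 1 else 0) \<partial>\<pi>) = (\<integral>\<^sup>+ z. indicator {z. P z} z \<partial>\<pi>)"
        by (intro nn_integral_cong) (auto simp: indicator_def)
      also have "\<dots> = emeasure \<pi> {z. P z}"
        using that by (intro nn_integral_indicator) (simp add: pred_def space)
      finally show ?thesis .
    qed
    show "(\<integral>\<^sup>+ z. ?k z s t \<partial>\<pi>) = layer_weight p s *
       (emeasure \<pi> {z. snd z \<le> t - s \<and> t < fst z} + emeasure \<pi> {z. fst z \<le> t - s \<and> t < snd z})"
      by (simp add: nn_integral_cmult nn_integral_add *)
  qed
  finally show ?thesis .
qed

text \<open>The integrand comes from the lower bound \<open>\<pi> {y \<le> b, a < x} \<ge> cdf \<nu> b - cdf \<mu> a\<close>, in which \<open>ennreal\<close>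
  takes the positive part.\<close>

definition monotone_cost :: "real \<Rightarrow> real measure \<Rightarrow> real measure \<Rightarrow> ennreal" where
  "monotone_cost p \<mu> \<nu> = (\<integral>\<^sup>+ s. \<integral>\<^sup>+ t. layer_weight p s *
     (ennreal (cdf \<nu> (t - s) - cdf \<mu> t) + ennreal (cdf \<mu> (t - s) - cdf \<nu> t)) \<partial>lborel \<partial>lborel)"

lemma monotone_cost_le:
  assumes p: "1 < p" and \<pi>: "\<pi> \<in> couplings \<mu> \<nu>"
  shows "monotone_cost p \<mu> \<nu> \<le> (\<integral>\<^sup>+ (x, y). ennreal (\<bar>x - y\<bar> powr p) \<partial>\<pi>)"
proof -
  have sets[measurable_cong]: "sets \<pi> = sets borel" and prob: "prob_space \<pi>"
    and \<mu>: "\<mu> = distr \<pi> borel fst" and \<nu>: "\<nu> = distr \<pi> borel snd"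
    using \<pi> by (auto simp: couplings_def)
  interpret prob_space \<pi> by fact
  have space: "space \<pi> = UNIV"
    using sets_eq_imp_space_eq[OF sets] by simp
  have [measurable]: "fst \<in> borel_measurable \<pi>" "snd \<in> borel_measurable \<pi>"
    by (simp_all add: borel_prod[symmetric] measurable_cong_sets[OF sets refl])
  \<comment> \<open>Union bound: where \<open>g z \<le> b\<close>, either \<open>a < f z\<close> or
    \<open>f z \<le> a\<close>. Arbitrary \<open>f\<close> and \<open>g\<close> allow both quadrants
    to be treated by exchanging \<open>fst\<close> and \<open>snd\<close>.\<close>
  have diff: "ennreal (measure \<pi> {z. g z \<le> b} - measure \<pi> {z. f z \<le> a})
      \<le> emeasure \<pi> {z. g z \<le> b \<and> a < f z}"
    if [measurable]: "f \<in> borel_measurable \<pi>" "g \<in> borel_measurable \<pi>"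
    for f g :: "real \<times> real \<Rightarrow> real" and a b
  proof -
    have [measurable]: "{z. g z \<le> b \<and> a < f z} \<in> sets \<pi>" "{z. f z \<le> a} \<in> sets \<pi>"
      "{z. g z \<le> b} \<in> sets \<pi>"
      using measurable_sets[OF that(1), of "{..a}"] measurable_sets[OF that(2), of "{..b}"]
        measurable_sets[OF that(1), of "{a<..}"]
      by (auto simp: vimage_def space Collect_conj_eq)
    have "measure \<pi> {z. g z \<le> b} \<le> measure \<pi> ({z. g z \<le> b \<and> a < f z} \<union> {z. f z \<le> a})"
      by (intro finite_measure_mono) auto
    also have "\<dots> \<le> measure \<pi> {z. g z \<le> b \<and> a < f z} + measure \<pi> {z. f z \<le> a}"
      by (intro measure_Un_le) auto
    finally show ?thesis
      by (simp add: emeasure_eq_measure)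
  qed
  have "cdf \<mu> x = measure \<pi> {z. fst z \<le> x}" "cdf \<nu> x = measure \<pi> {z. snd z \<le> x}" for x
    by (simp_all add: cdf_def \<mu> \<nu> measure_distr space vimage_def)
  then show ?thesis
    unfolding coupling_cost_eq[OF prob sets p] monotone_cost_def
    by (intro nn_integral_mono mult_left_mono add_mono) (simp_all add: diff)
qed

text \<open>Stated for arbitrary functions: besides the quantile coupling it serves the completeness
  proof, where one component is a limit function not known to be a quantile function.\<close>

lemma distr_Pair_in_couplings:
  assumes [measurable]: "f \<in> borel_measurable unit_measure" "g \<in> borel_measurable unit_measure"
  shows "distr unit_measure borel (\<lambda>u. (f u, g u))
    \<in> couplings (distr unit_measure borel f) (distr unit_measure borel g)"
proof -
  interpret prob_space unit_measure by (rule prob_space_unit_measure)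
  show ?thesis
    unfolding couplings_def
    by (auto intro!: prob_space_distr simp: distr_distr borel_prod[symmetric] comp_def)
qed

lemma quantile_coupling_in_couplings:
  assumes "real_distribution \<mu>" "real_distribution \<nu>"
  shows "distr unit_measure borel (\<lambda>u. (quantile \<mu> u, quantile \<nu> u)) \<in> couplings \<mu> \<nu>"
  using distr_Pair_in_couplings[OF assms[THEN measurable_quantile]]
  by (simp add: distr_quantile assms)

lemma cost_distr_Pair:
  assumes [measurable]: "f \<in> borel_measurable unit_measure" "g \<in> borel_measurable unit_measure"
  shows "(\<integral>\<^sup>+ (x, y). ennreal (\<bar>x - y\<bar> powr p) \<partial>distr unit_measure borel (\<lambda>u. (f u, g u)))
    = (\<integral>\<^sup>+ u. ennreal (\<bar>f u - g u\<bar> powr p) \<partial>unit_measure)"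
  by (subst nn_integral_distr) (auto simp: borel_prod[symmetric] split_beta)

text \<open>By the Galois connection the event is an interval between two values of the distribution
  functions, whose length is the positive part of their difference. This is exactly the lower bound
  valid for all couplings.\<close>

lemma emeasure_quantile_between:
  assumes \<mu>: "real_distribution \<mu>" and \<nu>: "real_distribution \<nu>"
  shows "emeasure unit_measure {u \<in> {0<..<1}. quantile \<nu> u \<le> b \<and> a < quantile \<mu> u}
    = ennreal (cdf \<nu> b - cdf \<mu> a)"
proof -
  interpret M: real_distribution \<mu> by fact
  interpret N: real_distribution \<nu> by fact
  have "emeasure unit_measure {u \<in> {0<..<1}. quantile \<nu> u \<le> b \<and> a < quantile \<mu> u}
      = emeasure unit_measure {u \<in> {0<..<1}. cdf \<mu> a < u \<and> u \<le> cdf \<nu> b}"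
    by (intro arg_cong[where f="emeasure unit_measure"] Collect_cong)
      (auto simp: quantile_le_iff[OF \<nu>] quantile_le_iff[OF \<mu>] not_le[symmetric])
  also have "\<dots> = emeasure lborel {u \<in> {0<..<1}. cdf \<mu> a < u \<and> u \<le> cdf \<nu> b}"
    by (intro emeasure_restrict_space) auto
  \<comment> \<open>Distribution functions take values between 0 and 1, so restricting to the open
    unit interval can lose only the point 1.\<close>
  also have "\<dots> = emeasure lborel {cdf \<mu> a<..cdf \<nu> b}"
    using AE_lborel_singleton[of "1::real"] M.cdf_nonneg[of a] N.cdf_bounded_prob[of b]
    by (intro emeasure_eq_AE) auto
  also have "\<dots> = ennreal (cdf \<nu> b - cdf \<mu> a)"
    by (cases "cdf \<mu> a \<le> cdf \<nu> b") (auto simp: ennreal_neg)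
  finally show ?thesis .
qed

lemma monotone_cost_eq:
  assumes p: "1 < p" and \<mu>: "real_distribution \<mu>" and \<nu>: "real_distribution \<nu>"
  shows "monotone_cost p \<mu> \<nu> =
    (\<integral>\<^sup>+ u. ennreal (\<bar>quantile \<mu> u - quantile \<nu> u\<bar> powr p) \<partial>unit_measure)"
proof -
  note [measurable] = measurable_quantile[OF \<mu>] measurable_quantile[OF \<nu>]
  let ?\<pi> = "distr unit_measure borel (\<lambda>u. (quantile \<mu> u, quantile \<nu> u))"
  have "?\<pi> \<in> couplings \<mu> \<nu>"
    using \<mu> \<nu> by (rule quantile_coupling_in_couplings)
  then have prob: "prob_space ?\<pi>"
    by (simp add: couplings_def)
  have meas: "(\<lambda>u. (quantile \<mu> u, quantile \<nu> u)) \<in> borel_measurable unit_measure"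
    by (simp add: borel_prod[symmetric])
  have 1: "{z :: real \<times> real. snd z \<le> b \<and> a < fst z} = UNIV \<times> {..b} \<inter> {a<..} \<times> UNIV"
    "{z :: real \<times> real. fst z \<le> b \<and> a < snd z} = {..b} \<times> UNIV \<inter> UNIV \<times> {a<..}" for a b
    by auto
  have [measurable]: "{z :: real \<times> real. snd z \<le> b \<and> a < fst z} \<in> sets borel"
    "{z :: real \<times> real. fst z \<le> b \<and> a < snd z} \<in> sets borel" for a b
    unfolding 1 borel_prod[symmetric] by measurable
  have "emeasure ?\<pi> {z. snd z \<le> b \<and> a < fst z} = ennreal (cdf \<nu> b - cdf \<mu> a)"
    "emeasure ?\<pi> {z. fst z \<le> b \<and> a < snd z} = ennreal (cdf \<mu> b - cdf \<nu> a)" for a b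
    unfolding emeasure_quantile_between[OF \<mu> \<nu>, symmetric] emeasure_quantile_between[OF \<nu> \<mu>, symmetric]
    by (auto simp: emeasure_distr meas space_restrict_space
        intro!: arg_cong[where f="emeasure unit_measure"])
  then show ?thesis
    unfolding cost_distr_Pair[OF measurable_quantile[OF \<mu>] measurable_quantile[OF \<nu>], symmetric]
      coupling_cost_eq[OF prob sets_distr p]
    by (simp add: monotone_cost_def)
qed

section \<open>Convexity and completeness in \<open>L\<^sup>p\<close>\<close>

text \<open>Mean value theorem and strict monotonicity of \<open>z powr (p - 1)\<close>. The
  strictness is what later yields a positive convexity gap.\<close>

lemma powr_tangent_less:
  fixes x m p :: real
  assumes "1 < p" "0 \<le> x" "0 < m" "x \<noteq> m"
  shows "m powr p + p * m powr (p - 1) * (x - m) < x powr p"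
\<comment> \<open>The derivative formula is available at positive points only. At 0 the left side
  equals \<open>(1 - p) * m powr p\<close>, which is negative.\<close>
proof (cases "x = 0")
  case True
  then show ?thesis
    using assms powr_mult_base[of m "p - 1"] by (simp add: algebra_simps)
next
  case False
  with assms have x: "0 < x" by simp
  have der: "((\<lambda>z. z powr p) has_real_derivative p * z powr (p - 1)) (at z)" if "0 < z" for z
    using that by (auto intro!: derivative_eq_intros)
  consider "x < m" | "m < x"
    using assms by linarith
  then show ?thesis
  proof cases
    case 1
    then obtain z where z: "x < z" "z < m" "m powr p - x powr p = (m - x) * (p * z powr (p - 1))"
      using MVT2[of x m "\<lambda>z. z powr p" "\<lambda>z. p * z powr (p - 1)"] der x by fastforce
    have "z powr (p - 1) < m powr (p - 1)"
      using z x assms by (intro powr_less_mono2) auto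
    with 1 assms have "(m - x) * (p * z powr (p - 1)) < (m - x) * (p * m powr (p - 1))"
      by simp
    with z(3) show ?thesis
      by (simp add: algebra_simps)
  next
    case 2
    then obtain z where z: "m < z" "z < x" "x powr p - m powr p = (x - m) * (p * z powr (p - 1))"
      using MVT2[of m x "\<lambda>z. z powr p" "\<lambda>z. p * z powr (p - 1)"] der assms by fastforce
    have "m powr (p - 1) < z powr (p - 1)"
      using z x assms by (intro powr_less_mono2) auto
    with 2 assms have "(x - m) * (p * m powr (p - 1)) < (x - m) * (p * z powr (p - 1))"
      by simp
    with z(3) show ?thesis
      by (simp add: algebra_simps)
  qed
qed

lemma convex_on_powr_nonneg:
  fixes p :: real
  assumes "1 < p"
  shows "convex_on {0..} (\<lambda>x. x powr p)"
proof (intro convex_onI)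
  fix t x y :: real
  assume t: "0 < t" "t < 1" and x: "x \<in> {0..}" and y: "y \<in> {0..}"
  define m where "m = (1 - t) * x + t * y"
  have "m powr p \<le> (1 - t) * x powr p + t * y powr p"
  \<comment> \<open>Tangents exist only at a positive barycentre; at \<open>m = 0\<close> the left
    side vanishes. Otherwise the tangent inequalities at \<open>m\<close> are averaged and their
    linear terms cancel.\<close>
  proof (cases "m = 0")
    case True
    then show ?thesis
      using t x y by simp
  next
    case False
    have "0 \<le> m"
      using t x y by (simp add: m_def)
    with False have "0 < m" by simp
    then have tan: "m powr p + p * m powr (p - 1) * (z - m) \<le> z powr p" if "0 \<le> z" for z
      using powr_tangent_less[OF assms that \<open>0 < m\<close>] by (cases "z = m") auto
    have "(1 - t) * (m powr p + p * m powr (p - 1) * (x - m))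
        + t * (m powr p + p * m powr (p - 1) * (y - m)) \<le> (1 - t) * x powr p + t * y powr p"
      using t x y tan by (intro add_mono mult_left_mono) auto
    also have "(1 - t) * (m powr p + p * m powr (p - 1) * (x - m))
        + t * (m powr p + p * m powr (p - 1) * (y - m))
        = m powr p + p * m powr (p - 1) * ((1 - t) * x + t * y - m)"
      by (simp add: algebra_simps)
    finally show ?thesis
      by (simp add: m_def)
  qed
  then show "((1 - t) *\<^sub>R x + t *\<^sub>R y) powr p \<le> (1 - t) * x powr p + t * y powr p"
    by (simp add: m_def)
qed auto

text \<open>The crude constant comes from bounding the sum by twice the maximum; it is enough for
  integrability and for a bound on a compact set.\<close>

lemma abs_add_powr_le:
  fixes a b p :: real
  assumes "0 \<le> p"
  shows "\<bar>a + b\<bar> powr p \<le> 2 powr p * (\<bar>a\<bar> powr p + \<bar>b\<bar> powr p)"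
proof -
  have "\<bar>a + b\<bar> powr p \<le> (2 * max \<bar>a\<bar> \<bar>b\<bar>) powr p"
    using assms by (intro powr_mono2) auto
  also have "\<dots> \<le> 2 powr p * (\<bar>a\<bar> powr p + \<bar>b\<bar> powr p)"
    by (auto simp: powr_mult max_def)
  finally show ?thesis .
qed

lemma integrable_abs_add_powr:
  fixes f g :: "'a \<Rightarrow> real"
  assumes "0 \<le> p" and [measurable]: "f \<in> borel_measurable M" "g \<in> borel_measurable M"
    and "integrable M (\<lambda>x. \<bar>f x\<bar> powr p)" "integrable M (\<lambda>x. \<bar>g x\<bar> powr p)"
  shows "integrable M (\<lambda>x. \<bar>f x + g x\<bar> powr p)"
proof (rule Bochner_Integration.integrable_bound)
  show "integrable M (\<lambda>x. 2 powr p * (\<bar>f x\<bar> powr p + \<bar>g x\<bar> powr p))"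
    using assms by simp
  show "AE x in M. norm (\<bar>f x + g x\<bar> powr p) \<le> norm (2 powr p * (\<bar>f x\<bar> powr p + \<bar>g x\<bar> powr p))"
    using abs_add_powr_le[OF assms(1)] by simp
qed measurable

text \<open>Minkowski by convexity instead of Hoelder: \<open>(x + y) / (a + b)\<close> is the
  convex combination of \<open>x / a\<close> and \<open>y / b\<close> with weights
  \<open>a / (a + b)\<close> and \<open>b / (a + b)\<close>. Taking \<open>a\<close> and
  \<open>b\<close> as positive upper bounds of the norms avoids dividing by a zero norm.\<close>

lemma integral_abs_add_powr_le:
  fixes f g :: "'a \<Rightarrow> real"
  assumes p: "1 < p" and meas: "f \<in> borel_measurable M" "g \<in> borel_measurable M"
    and int: "integrable M (\<lambda>x. \<bar>f x\<bar> powr p)" "integrable M (\<lambda>x. \<bar>g x\<bar> powr p)"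
    and a: "0 < a" "(\<integral>x. \<bar>f x\<bar> powr p \<partial>M) \<le> a powr p"
    and b: "0 < b" "(\<integral>x. \<bar>g x\<bar> powr p \<partial>M) \<le> b powr p"
  shows "(\<integral>x. \<bar>f x + g x\<bar> powr p \<partial>M) \<le> (a + b) powr p"
proof -
  define t where "t = b / (a + b)"
  have t: "0 \<le> t" "t \<le> 1" "1 - t = a / (a + b)"
    using a b by (auto simp: t_def field_simps)
  have pw: "\<bar>x + y\<bar> powr p \<le> (a + b) powr p *
      ((1 - t) * (\<bar>x\<bar> powr p / a powr p) + t * (\<bar>y\<bar> powr p / b powr p))" for x y :: real
  proof -
    have "\<bar>x + y\<bar> \<le> (a + b) * ((1 - t) * (\<bar>x\<bar> / a) + t * (\<bar>y\<bar> / b))"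
      using a b by (simp add: t(3) distrib_left) (simp add: t_def)
    then have "\<bar>x + y\<bar> powr p \<le> ((a + b) * ((1 - t) * (\<bar>x\<bar> / a) + t * (\<bar>y\<bar> / b))) powr p"
      using p by (intro powr_mono2) auto
    also have "\<dots> = (a + b) powr p * ((1 - t) * (\<bar>x\<bar> / a) + t * (\<bar>y\<bar> / b)) powr p"
      using a b t by (intro powr_mult)
    also have "((1 - t) * (\<bar>x\<bar> / a) + t * (\<bar>y\<bar> / b)) powr p
        \<le> (1 - t) * (\<bar>x\<bar> / a) powr p + t * (\<bar>y\<bar> / b) powr p"
      using convex_onD[OF convex_on_powr_nonneg[OF p], of t "\<bar>x\<bar> / a" "\<bar>y\<bar> / b"] a b t by simp
    also have "\<dots> = (1 - t) * (\<bar>x\<bar> powr p / a powr p) + t * (\<bar>y\<bar> powr p / b powr p)"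
      using a b by (simp add: powr_divide)
    finally show ?thesis
      by (simp add: mult_left_mono)
  qed
  have "(\<integral>x. \<bar>f x + g x\<bar> powr p \<partial>M) \<le> (\<integral>x. (a + b) powr p *
      ((1 - t) * (\<bar>f x\<bar> powr p / a powr p) + t * (\<bar>g x\<bar> powr p / b powr p)) \<partial>M)"
    using p pw int meas by (intro integral_mono integrable_abs_add_powr) auto
  also have "\<dots> = (a + b) powr p * ((1 - t) * ((\<integral>x. \<bar>f x\<bar> powr p \<partial>M) / a powr p)
      + t * ((\<integral>x. \<bar>g x\<bar> powr p \<partial>M) / b powr p))"
    using int by simp
  also have "\<dots> \<le> (a + b) powr p * ((1 - t) * 1 + t * 1)"
    using a b t by (intro mult_left_mono add_mono) (auto simp: divide_le_eq)
  finally show ?thesis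
    by simp
qed

lemma Minkowski_inequality:
  fixes f g :: "'a \<Rightarrow> real"
  assumes p: "1 < p" and meas: "f \<in> borel_measurable M" "g \<in> borel_measurable M"
    and int: "integrable M (\<lambda>x. \<bar>f x\<bar> powr p)" "integrable M (\<lambda>x. \<bar>g x\<bar> powr p)"
  shows "(\<integral>x. \<bar>f x + g x\<bar> powr p \<partial>M) powr (1 / p)
    \<le> (\<integral>x. \<bar>f x\<bar> powr p \<partial>M) powr (1 / p) + (\<integral>x. \<bar>g x\<bar> powr p \<partial>M) powr (1 / p)"
    (is "_ \<le> ?a powr _ + ?b powr _")
proof (rule field_le_epsilon)
  fix e :: real
  assume e: "0 < e"
  \<comment> \<open>Each norm is enlarged by \<open>e / 2\<close> to a positive bound, which also
    covers functions of norm 0.\<close>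
  have le: "c \<le> (c powr (1 / p) + e / 2) powr p" if "0 \<le> c" for c
  proof -
    have "c = (c powr (1 / p)) powr p"
      using p that by (simp add: powr_powr)
    also have "\<dots> \<le> (c powr (1 / p) + e / 2) powr p"
      using p e by (intro powr_mono2) auto
    finally show ?thesis .
  qed
  have "(\<integral>x. \<bar>f x + g x\<bar> powr p \<partial>M) \<le> ((?a powr (1 / p) + e / 2) + (?b powr (1 / p) + e / 2)) powr p"
    using e by (intro integral_abs_add_powr_le[OF p meas int] le add_nonneg_pos) auto
  then have "(\<integral>x. \<bar>f x + g x\<bar> powr p \<partial>M) powr (1 / p)
    \<le> (((?a powr (1 / p) + e / 2) + (?b powr (1 / p) + e / 2)) powr p) powr (1 / p)"
    using p by (intro powr_mono2) auto
  also have "\<dots> = ?a powr (1 / p) + ?b powr (1 / p) + e"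
    using p e by (simp add: powr_powr add_nonneg_nonneg)
  finally show "(\<integral>x. \<bar>f x + g x\<bar> powr p \<partial>M) powr (1 / p) \<le> ?a powr (1 / p) + ?b powr (1 / p) + e" .
qed

section \<open>Uniform convexity of the p-th power\<close>

lemma abs_midpoint_powr_less:
  fixes a b p :: real
  assumes p: "1 < p" and "a \<noteq> b"
  shows "\<bar>(a + b) / 2\<bar> powr p < (\<bar>a\<bar> powr p + \<bar>b\<bar> powr p) / 2"
proof (cases "\<bar>a\<bar> = \<bar>b\<bar>")
  case True
  \<comment> \<open>Here strictness comes from cancellation, as the midpoint is 0. In the other case
    it comes from the strict tangent inequality at the mean of the absolute values.\<close>
  with assms have "b = - a" "a \<noteq> 0"
    by (auto simp: abs_eq_iff)
  with p show ?thesis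
    by simp
next
  case False
  define m where "m = (\<bar>a\<bar> + \<bar>b\<bar>) / 2"
  have m: "0 < m" "\<bar>a\<bar> \<noteq> m" "\<bar>b\<bar> \<noteq> m" "\<bar>a\<bar> - m = - (\<bar>b\<bar> - m)"
    using False by (auto simp: m_def field_simps)
  have "m powr p + p * m powr (p - 1) * (\<bar>a\<bar> - m) < \<bar>a\<bar> powr p"
    "m powr p + p * m powr (p - 1) * (\<bar>b\<bar> - m) < \<bar>b\<bar> powr p"
    by (intro powr_tangent_less[OF p] abs_ge_zero m)+
  then have "m powr p < (\<bar>a\<bar> powr p + \<bar>b\<bar> powr p) / 2"
    using m(4) by (simp add: field_simps)
  moreover have "\<bar>(a + b) / 2\<bar> powr p \<le> m powr p"
    using p by (intro powr_mono2) (auto simp: m_def)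
  ultimately show ?thesis
    by simp
qed

text \<open>A quantitative strict convexity of \<open>\<bar>x\<bar> powr p\<close> that replaces Clarkson's inequalities and
  needs no distinction between \<open>p \<le> 2\<close> and \<open>p \<ge> 2\<close>: by homogeneity it suffices to
  bound the convexity gap from below on a compact set.\<close>

lemma abs_diff_powr_le_midpoint_gap:
  fixes p \<epsilon> :: real
  assumes p: "1 < p" and \<epsilon>: "0 < \<epsilon>"
  obtains C where "0 \<le> C"
    "\<And>a b. \<bar>a - b\<bar> powr p \<le> \<epsilon> * (\<bar>a\<bar> powr p + \<bar>b\<bar> powr p)
       + C * ((\<bar>a\<bar> powr p + \<bar>b\<bar> powr p) / 2 - \<bar>(a + b) / 2\<bar> powr p)"
proof -
  define N where "N z = \<bar>fst z\<bar> powr p + \<bar>snd z\<bar> powr p" for z :: "real \<times> real"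
  define D where "D z = \<bar>fst z - snd z\<bar> powr p" for z :: "real \<times> real"
  define G where "G z = N z / 2 - \<bar>(fst z + snd z) / 2\<bar> powr p" for z :: "real \<times> real"
  \<comment> \<open>Outside \<open>K\<close> the \<epsilon>-term alone bounds \<open>D\<close> on
    the unit sphere of the maximum norm. The non-strict inequality makes \<open>K\<close> closed,
    and it excludes the diagonal, where \<open>D\<close> vanishes but \<open>N\<close> does not; so
    the gap \<open>G\<close> is positive on \<open>K\<close>.\<close>
  define K where "K = {z. max \<bar>fst z\<bar> \<bar>snd z\<bar> = 1 \<and> \<epsilon> * N z \<le> D z}"
  have cont: "continuous_on S N" "continuous_on S D" "continuous_on S G" for S
    unfolding N_def D_def G_def using p by (intro continuous_intros continuous_on_powr'; auto)+
  have N_le: "D z \<le> 2 powr p * N z" for z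
    using abs_add_powr_le[of p "fst z" "- snd z"] p by (simp add: D_def N_def)
  have G_pos: "0 < G z" if "fst z \<noteq> snd z" for z
    using abs_midpoint_powr_less[OF p that] by (simp add: G_def N_def)
  have G_nonneg: "0 \<le> G z" for z
    using G_pos[of z] by (cases "fst z = snd z") (auto simp: G_def N_def)
  have N_pos: "0 < N z" if "z \<noteq> 0" for z
    using that by (auto simp: N_def prod_eq_iff add_pos_nonneg add_nonneg_pos)
  have "compact K"
  proof -
    have "closed K"
      unfolding K_def
      by (intro closed_Collect_conj closed_Collect_eq closed_Collect_le continuous_intros cont)
    moreover have "compact ({-1..1::real} \<times> {-1..1::real})"
      by (intro compact_Times compact_Icc)
    moreover have "{-1..1} \<times> {-1..1} \<inter> K = K"
      by (auto simp: K_def)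
    ultimately show ?thesis
      by (metis compact_Int_closed)
  qed
  have "\<exists>\<delta>>0. \<forall>z\<in>K. \<delta> \<le> G z"
  \<comment> \<open>For large \<epsilon> the set \<open>K\<close> is empty, and any positive number
    will do.\<close>
  proof (cases "K = {}")
    case True
    then show ?thesis
      by (auto intro: exI[of _ 1])
  next
    case False
    obtain z0 where z0: "z0 \<in> K" "\<And>z. z \<in> K \<Longrightarrow> G z0 \<le> G z"
      using continuous_attains_inf[OF \<open>compact K\<close> False cont(3)] by blast
    have "fst z0 \<noteq> snd z0"
    proof
      assume "fst z0 = snd z0"
      with z0(1) have "\<epsilon> * N z0 \<le> 0" "z0 \<noteq> 0"
        by (auto simp: K_def D_def)
      then show False
        using mult_pos_pos[OF \<epsilon> N_pos] by (simp add: not_le[symmetric])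
    qed
    then show ?thesis
      using G_pos z0(2) by blast
  qed
  then obtain \<delta> where \<delta>: "0 < \<delta>" "\<And>z. z \<in> K \<Longrightarrow> \<delta> \<le> G z"
    by blast
  \<comment> \<open>On \<open>K\<close> both coordinates are at most 1 in absolute value, so
    \<open>N \<le> 2\<close> and \<open>D \<le> 2 powr p * 2\<close>, while
    \<open>G \<ge> \<delta>\<close>.\<close>
  define C where "C = 2 powr p * 2 / \<delta>"
  have "0 \<le> C"
    using \<delta> by (simp add: C_def)
  have unit: "D z \<le> \<epsilon> * N z + C * G z" if "max \<bar>fst z\<bar> \<bar>snd z\<bar> = 1" for z
  proof (cases "z \<in> K")
    case True
    have "1 powr p + 1 powr p \<ge> N z"
      unfolding N_def using that p by (intro add_mono powr_mono2) auto
    then have "2 powr p * N z \<le> 2 powr p * 2"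
      by (intro mult_left_mono) auto
    with N_le[of z] have "D z \<le> 2 powr p * 2"
      by (rule order_trans)
    also have "\<dots> = C * \<delta>"
      using \<delta> by (simp add: C_def)
    also have "\<dots> \<le> C * G z"
      using \<delta>(2)[OF True] \<open>0 \<le> C\<close> by (rule mult_left_mono)
    also have "\<dots> \<le> \<epsilon> * N z + C * G z"
      using \<epsilon> by (simp add: N_def)
    finally show ?thesis .
  next
    case False
    then have "D z \<le> \<epsilon> * N z"
      using that by (simp add: K_def)
    also have "\<dots> \<le> \<epsilon> * N z + C * G z"
      using G_nonneg \<open>0 \<le> C\<close> by simp
    finally show ?thesis .
  qed
  have "D z \<le> \<epsilon> * N z + C * G z" for z
  proof (cases "z = 0")
    case True
    then show ?thesis
      using p by (simp add: D_def N_def G_def)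
  next
    case False
    define r where "r = max \<bar>fst z\<bar> \<bar>snd z\<bar>"
    define w where "w = (fst z / r, snd z / r)"
    have r: "0 < r"
      using False by (auto simp: r_def prod_eq_iff less_max_iff_disj)
    then have "max \<bar>fst w\<bar> \<bar>snd w\<bar> = 1"
      by (auto simp: w_def r_def max_def)
    note unit_w = unit[OF this]
    have fz: "fst z = r * fst w" "snd z = r * snd w"
      using r by (auto simp: w_def)
    have N: "N z = r powr p * N w"
      using r by (simp add: N_def fz abs_mult powr_mult distrib_left)
    have *: "\<bar>r * x\<bar> powr p = r powr p * \<bar>x\<bar> powr p" for x
      using r by (simp add: abs_mult powr_mult)
    have D: "D z = r powr p * D w"
      using *[of "fst w - snd w"] by (simp add: D_def fz algebra_simps)
    have G: "G z = r powr p * G w"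
      using *[of "(fst w + snd w) / 2"] unfolding G_def N by (simp add: fz algebra_simps)
    have "r powr p * D w \<le> r powr p * (\<epsilon> * N w + C * G w)"
      using unit_w by (intro mult_left_mono) auto
    then show ?thesis
      by (simp add: D N G algebra_simps)
  qed
  from this[of "(_, _)"] show ?thesis
    using that[OF \<open>0 \<le> C\<close>] by (simp add: D_def G_def N_def)
qed

text \<open>The Riesz-Fischer argument: on a finite measure space the increments have summable first
  moments, so their series converges absolutely almost everywhere.\<close>

lemma AE_convergent_if_geometric_powr_diffs:
  fixes f :: "nat \<Rightarrow> 'a \<Rightarrow> real"
  assumes "finite_measure M" and p: "1 < p" and [measurable]: "\<And>k. f k \<in> borel_measurable M"
    and le: "\<And>k. (\<integral>\<^sup>+x. ennreal (\<bar>f (Suc k) x - f k x\<bar> powr p) \<partial>M) \<le> ennreal (((1/2) ^ k) powr p)"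
  shows "AE x in M. convergent (\<lambda>k. f k x)"
proof -
  interpret finite_measure M by fact
  define r :: "nat \<Rightarrow> real" where "r k = (1/2) ^ k" for k
  have r: "0 < r k" for k
    by (simp add: r_def)
  \<comment> \<open>Replaces Hoelder in the passage from p-th to first moments:
    \<open>t \<le> 1 + t powr p\<close> at \<open>t = \<bar>x\<bar> / r k\<close>. This scaling
    makes both terms integrate to a multiple of \<open>r k\<close>.\<close>
  have pw: "\<bar>x\<bar> \<le> r k + r k / r k powr p * \<bar>x\<bar> powr p" for x k
  proof -
    have "t \<le> 1 + t powr p" if "0 \<le> t" for t :: real
    proof (cases "t \<le> 1")
      case False
      then have "t powr 1 \<le> t powr p"
        using p by (intro powr_mono) auto
      with False show ?thesis by simp
    qed (use powr_ge_zero[of t p] in linarith)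
    from this[of "\<bar>x\<bar> / r k"] have "r k * (\<bar>x\<bar> / r k) \<le> r k * (1 + (\<bar>x\<bar> / r k) powr p)"
      using r[of k] by (intro mult_left_mono) auto
    then show ?thesis
      using r[of k] by (simp add: powr_divide distrib_left)
  qed
  have int: "(\<integral>\<^sup>+x. ennreal \<bar>f (Suc k) x - f k x\<bar> \<partial>M) \<le> ennreal (r k * (measure M (space M) + 1))" for k
  proof -
    have "(\<integral>\<^sup>+x. ennreal \<bar>f (Suc k) x - f k x\<bar> \<partial>M)
        \<le> (\<integral>\<^sup>+x. ennreal (r k) + ennreal (r k / r k powr p) * ennreal (\<bar>f (Suc k) x - f k x\<bar> powr p) \<partial>M)"
      using r[of k] pw by (intro nn_integral_mono)
        (simp add: ennreal_plus[symmetric] ennreal_mult[symmetric] del: ennreal_plus)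
    also have "\<dots> = ennreal (r k) * emeasure M (space M) + ennreal (r k / r k powr p) *
        (\<integral>\<^sup>+x. ennreal (\<bar>f (Suc k) x - f k x\<bar> powr p) \<partial>M)"
      by (simp add: nn_integral_add nn_integral_cmult)
    also have "\<dots> \<le> ennreal (r k) * emeasure M (space M) + ennreal (r k / r k powr p) *
        ennreal (r k powr p)"
      unfolding r_def by (intro add_mono mult_left_mono le) auto
    also have "\<dots> = ennreal (r k * (measure M (space M) + 1))"
      using r[of k] by (simp add: emeasure_eq_measure ennreal_plus[symmetric] ennreal_mult[symmetric]
          distrib_left del: ennreal_plus)
    finally show ?thesis .
  qed
  have "(\<integral>\<^sup>+x. (\<Sum>k. ennreal \<bar>f (Suc k) x - f k x\<bar>) \<partial>M)
      = (\<Sum>k. \<integral>\<^sup>+x. ennreal \<bar>f (Suc k) x - f k x\<bar> \<partial>M)"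
    by (intro nn_integral_suminf) measurable
  also have "\<dots> \<le> (\<Sum>k. ennreal (r k * (measure M (space M) + 1)))"
    by (intro suminf_le int summableI)
  also have "\<dots> = ennreal (\<Sum>k. r k * (measure M (space M) + 1))"
    using r by (intro suminf_ennreal2) (auto simp: r_def less_imp_le intro!: summable_mult2 mult_nonneg_nonneg)
  also have "\<dots> < \<infinity>"
    by simp
  finally have "AE x in M. (\<Sum>k. ennreal \<bar>f (Suc k) x - f k x\<bar>) \<noteq> \<infinity>"
    by (intro nn_integral_PInf_AE) auto
  then show ?thesis
  proof eventually_elim
    case (elim x)
    then have "summable (\<lambda>k. norm (f (Suc k) x - f k x))"
      by (intro summable_suminf_not_top) auto
    then have "summable (\<lambda>k. f (Suc k) x - f k x)"
      by (rule summable_norm_cancel)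
    then have "convergent (\<lambda>n. (\<Sum>k<n. f (Suc k) x - f k x) + f 0 x)"
      by (intro convergent_add convergent_const) (simp add: summable_iff_convergent)
    then show ?case
      by (simp add: sum_lessThan_telescope[of "\<lambda>k. f k x"])
  qed
qed

text \<open>Fatou's lemma, for bounds that hold from some index on.\<close>

lemma nn_integral_le_of_AE_tendsto:
  fixes f :: "nat \<Rightarrow> 'a \<Rightarrow> ennreal"
  assumes [measurable]: "\<And>n. f n \<in> borel_measurable M"
    and lim: "AE x in M. (\<lambda>n. f n x) \<longlonglongrightarrow> g x"
    and le: "\<And>n. N \<le> n \<Longrightarrow> integral\<^sup>N M (f n) \<le> c"
  shows "integral\<^sup>N M g \<le> c"
proof -
  have "integral\<^sup>N M g = (\<integral>\<^sup>+x. liminf (\<lambda>n. f n x) \<partial>M)"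
    using lim by (intro nn_integral_cong_AE) (auto elim!: eventually_mono simp: lim_imp_Liminf)
  also have "\<dots> \<le> liminf (\<lambda>n. integral\<^sup>N M (f n))"
    by (intro nn_integral_liminf) measurable
  also have "\<dots> \<le> c"
    using le by (intro Liminf_le) (auto intro!: eventually_sequentiallyI[of N])
  finally show ?thesis .
qed

section \<open>The Wasserstein metric as an \<open>L\<^sup>p\<close> distance of quantile functions\<close>

text \<open>The p-th power of the distance, without the root, so that pointwise inequalities can be
  integrated directly. A Bochner integral has default value 0 when the integrand is not integrable,
  so moments must be finite wherever it stands for the cost.\<close>

definition quantile_cost :: "real \<Rightarrow> real measure \<Rightarrow> real measure \<Rightarrow> real" where
  "quantile_cost p \<mu> \<nu> = (\<integral>u. \<bar>quantile \<mu> u - quantile \<nu> u\<bar> powr p \<partial>unit_measure)"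

lemma quantile_cost_nonneg: "0 \<le> quantile_cost p \<mu> \<nu>"
  by (simp add: quantile_cost_def)

lemma finite_moment_real_distribution:
  "\<mu> \<in> finite_moment_measures p \<Longrightarrow> real_distribution \<mu>"
  by (simp add: finite_moment_measures_def)

lemma finite_moment_distr:
  assumes [measurable]: "g \<in> borel_measurable unit_measure"
    and "integrable unit_measure (\<lambda>u. \<bar>g u\<bar> powr p)"
  shows "distr unit_measure borel g \<in> finite_moment_measures p"
proof -
  interpret prob_space unit_measure by (rule prob_space_unit_measure)
  show ?thesis
    using assms by (simp add: finite_moment_measures_def integrable_distr_eq real_distribution_distr)
qed

lemma integrable_quantile_powr:
  assumes "\<mu> \<in> finite_moment_measures p"
  shows "integrable unit_measure (\<lambda>u. \<bar>quantile \<mu> u\<bar> powr p)"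
proof -
  have \<mu>: "real_distribution \<mu>"
    using assms by (rule finite_moment_real_distribution)
  have "integrable (distr unit_measure borel (quantile \<mu>)) (\<lambda>x. \<bar>x\<bar> powr p)"
    using assms by (simp add: distr_quantile[OF \<mu>] finite_moment_measures_def)
  then show ?thesis
    by (subst (asm) integrable_distr_eq) (auto intro: measurable_quantile \<mu>)
qed

lemma integrable_quantile_diff_powr:
  assumes "0 \<le> p" "\<mu> \<in> finite_moment_measures p" "\<nu> \<in> finite_moment_measures p"
  shows "integrable unit_measure (\<lambda>u. \<bar>quantile \<mu> u - quantile \<nu> u\<bar> powr p)"
proof -
  have "integrable unit_measure (\<lambda>u. \<bar>quantile \<mu> u + - quantile \<nu> u\<bar> powr p)"
    using assms
    by (intro integrable_abs_add_powr borel_measurable_uminus measurable_quantile)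
      (auto simp: integrable_quantile_powr finite_moment_real_distribution)
  then show ?thesis by simp
qed

lemma wasserstein_le:
  assumes "0 \<le> p" "\<pi> \<in> couplings \<mu> \<nu>" "0 \<le> c"
    and "(\<integral>\<^sup>+ (x, y). ennreal (\<bar>x - y\<bar> powr p) \<partial>\<pi>) \<le> ennreal c"
  shows "wasserstein p \<mu> \<nu> \<le> c powr (1 / p)"
proof -
  let ?I = "INF \<pi>\<in>couplings \<mu> \<nu>. \<integral>\<^sup>+ (x, y). ennreal (\<bar>x - y\<bar> powr p) \<partial>\<pi>"
  have "?I \<le> ennreal c"
    using assms by (intro INF_lower2[of \<pi>])
  then have "enn2real ?I \<le> c"
    using assms(3) by (simp add: enn2real_leI)
  then show ?thesis
    using assms unfolding wasserstein_def by (intro powr_mono2) auto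
qed

lemma wasserstein_eq_quantile_cost:
  assumes p: "1 < p" and \<mu>: "\<mu> \<in> finite_moment_measures p" and \<nu>: "\<nu> \<in> finite_moment_measures p"
  shows "wasserstein p \<mu> \<nu> = quantile_cost p \<mu> \<nu> powr (1 / p)"
proof -
  note rd = \<mu>[THEN finite_moment_real_distribution] \<nu>[THEN finite_moment_real_distribution]
  have "(INF \<pi>\<in>couplings \<mu> \<nu>. \<integral>\<^sup>+ (x, y). ennreal (\<bar>x - y\<bar> powr p) \<partial>\<pi>) = monotone_cost p \<mu> \<nu>"
  proof (rule antisym)
    show "(INF \<pi>\<in>couplings \<mu> \<nu>. \<integral>\<^sup>+ (x, y). ennreal (\<bar>x - y\<bar> powr p) \<partial>\<pi>) \<le> monotone_cost p \<mu> \<nu>"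
      by (rule INF_lower2[OF quantile_coupling_in_couplings[OF rd]])
        (simp add: cost_distr_Pair measurable_quantile rd monotone_cost_eq[OF p])
  qed (intro INF_greatest monotone_cost_le p)
  \<comment> \<open>Finite moments make the cost finite, so neither the Bochner integral nor
    \<open>enn2real\<close> falls back to a default value.\<close>
  also have "\<dots> = ennreal (quantile_cost p \<mu> \<nu>)"
    unfolding monotone_cost_eq[OF p rd] quantile_cost_def
    using p \<mu> \<nu> by (intro nn_integral_eq_integral integrable_quantile_diff_powr) auto
  finally show ?thesis
    by (simp add: wasserstein_def quantile_cost_nonneg)
qed

lemma wasserstein_powr:
  assumes "1 < p" "\<mu> \<in> finite_moment_measures p" "\<nu> \<in> finite_moment_measures p"
  shows "wasserstein p \<mu> \<nu> powr p = quantile_cost p \<mu> \<nu>"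
  using assms by (simp add: wasserstein_eq_quantile_cost powr_powr quantile_cost_nonneg)

lemma wasserstein_nonneg: "0 \<le> wasserstein p \<mu> \<nu>"
  by (simp add: wasserstein_def)

lemma wasserstein_le_iff_quantile_cost_le:
  assumes "1 < p" "\<mu> \<in> finite_moment_measures p" "\<nu> \<in> finite_moment_measures p"
    and "\<mu>' \<in> finite_moment_measures p" "\<nu>' \<in> finite_moment_measures p"
  shows "wasserstein p \<mu> \<nu> \<le> wasserstein p \<mu>' \<nu>' \<longleftrightarrow> quantile_cost p \<mu> \<nu> \<le> quantile_cost p \<mu>' \<nu>'"
proof
  show "wasserstein p \<mu> \<nu> \<le> wasserstein p \<mu>' \<nu>'" if "quantile_cost p \<mu> \<nu> \<le> quantile_cost p \<mu>' \<nu>'"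
    using that assms
    by (auto simp: wasserstein_eq_quantile_cost quantile_cost_nonneg intro!: powr_mono2)
  show "quantile_cost p \<mu> \<nu> \<le> quantile_cost p \<mu>' \<nu>'" if "wasserstein p \<mu> \<nu> \<le> wasserstein p \<mu>' \<nu>'"
    using that assms
    by (auto simp: wasserstein_powr[symmetric] wasserstein_nonneg intro!: powr_mono2)
qed

text \<open>Vanishing cost gives equality of the quantile functions almost everywhere, which already
  fixes their laws.\<close>

lemma eq_if_quantile_cost_eq_0:
  assumes p: "1 < p" and \<mu>: "\<mu> \<in> finite_moment_measures p" and \<nu>: "\<nu> \<in> finite_moment_measures p"
    and 0: "quantile_cost p \<mu> \<nu> = 0"
  shows "\<mu> = \<nu>"
proof -
  note rd = \<mu>[THEN finite_moment_real_distribution] \<nu>[THEN finite_moment_real_distribution]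
  have "AE u in unit_measure. \<bar>quantile \<mu> u - quantile \<nu> u\<bar> powr p = 0"
    using 0 p \<mu> \<nu> unfolding quantile_cost_def
    by (subst (asm) integral_nonneg_eq_0_iff_AE) (auto intro!: integrable_quantile_diff_powr)
  then have "distr unit_measure borel (quantile \<mu>) = distr unit_measure borel (quantile \<nu>)"
    using rd by (intro distr_cong_AE measurable_quantile) auto
  then show ?thesis
    by (simp add: distr_quantile rd)
qed

lemma wasserstein_triangle:
  assumes p: "1 < p" and \<mu>: "\<mu> \<in> finite_moment_measures p" and \<nu>: "\<nu> \<in> finite_moment_measures p"
    and \<rho>: "\<rho> \<in> finite_moment_measures p"
  shows "wasserstein p \<mu> \<rho> \<le> wasserstein p \<mu> \<nu> + wasserstein p \<nu> \<rho>"
proof -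
  note rd = \<mu>[THEN finite_moment_real_distribution] \<nu>[THEN finite_moment_real_distribution]
    \<rho>[THEN finite_moment_real_distribution]
  note [measurable] = rd[THEN measurable_quantile]
  have "(\<integral>u. \<bar>(quantile \<mu> u - quantile \<nu> u) + (quantile \<nu> u - quantile \<rho> u)\<bar> powr p \<partial>unit_measure) powr (1 / p)
      \<le> wasserstein p \<mu> \<nu> + wasserstein p \<nu> \<rho>"
    unfolding wasserstein_eq_quantile_cost[OF p \<mu> \<nu>] wasserstein_eq_quantile_cost[OF p \<nu> \<rho>]
      quantile_cost_def
    using p \<mu> \<nu> \<rho> by (intro Minkowski_inequality integrable_quantile_diff_powr) auto
  then show ?thesis
    by (simp add: wasserstein_eq_quantile_cost[OF p \<mu> \<rho>] quantile_cost_def)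
qed

lemma Metric_space_wasserstein:
  assumes p: "1 < p"
  shows "Metric_space (finite_moment_measures p) (wasserstein p)"
proof
  show "wasserstein p \<mu> \<nu> = wasserstein p \<nu> \<mu>" for \<mu> \<nu>
  proof -
    have le: "(INF \<pi>\<in>couplings \<mu> \<nu>. \<integral>\<^sup>+ (x, y). ennreal (\<bar>x - y\<bar> powr p) \<partial>\<pi>)
      \<le> (INF \<pi>\<in>couplings \<nu> \<mu>. \<integral>\<^sup>+ (x, y). ennreal (\<bar>x - y\<bar> powr p) \<partial>\<pi>)" for \<mu> \<nu>
    proof (rule INF_greatest)
      fix \<pi> assume \<pi>: "\<pi> \<in> couplings \<nu> \<mu>"
      then have sets: "sets \<pi> = sets borel"
        by (simp add: couplings_def)
      interpret prob_space \<pi>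
        using \<pi> by (simp add: couplings_def)
      have [measurable]: "fst \<in> borel_measurable \<pi>" "snd \<in> borel_measurable \<pi>"
        by (simp_all add: borel_prod[symmetric] measurable_cong_sets[OF sets refl])
      have swap: "(\<lambda>z. (snd z, fst z)) \<in> borel_measurable \<pi>"
        by (simp add: borel_prod[symmetric])
      have [measurable]: "(fst :: real \<times> real \<Rightarrow> real) \<in> borel_measurable borel"
        "(snd :: real \<times> real \<Rightarrow> real) \<in> borel_measurable borel"
        by (simp_all add: borel_prod[symmetric])
      have "distr \<pi> borel (\<lambda>z. (snd z, fst z)) \<in> couplings \<mu> \<nu>"
        using \<pi> swap unfolding couplings_def
        by (auto intro!: prob_space_distr simp: distr_distr comp_def borel_prod[symmetric])
      then show "(INF \<pi>\<in>couplings \<mu> \<nu>. \<integral>\<^sup>+ (x, y). ennreal (\<bar>x - y\<bar> powr p) \<partial>\<pi>)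
          \<le> (\<integral>\<^sup>+ (x, y). ennreal (\<bar>x - y\<bar> powr p) \<partial>\<pi>)"
      proof (rule INF_lower2)
        show "(\<integral>\<^sup>+ (x, y). ennreal (\<bar>x - y\<bar> powr p) \<partial>distr \<pi> borel (\<lambda>z. (snd z, fst z)))
            \<le> (\<integral>\<^sup>+ (x, y). ennreal (\<bar>x - y\<bar> powr p) \<partial>\<pi>)"
          by (subst nn_integral_distr[OF swap])
            (auto simp: borel_prod[symmetric] case_prod_beta' abs_minus_commute)
      qed
    qed
    show ?thesis
      unfolding wasserstein_def using le[of \<mu> \<nu>] le[of \<nu> \<mu>] by simp
  qed
  show "wasserstein p \<mu> \<nu> = 0 \<longleftrightarrow> \<mu> = \<nu>"
    if "\<mu> \<in> finite_moment_measures p" "\<nu> \<in> finite_moment_measures p" for \<mu> \<nu>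
    using that p eq_if_quantile_cost_eq_0[OF p that]
    by (auto simp: wasserstein_eq_quantile_cost quantile_cost_def)
qed (use p wasserstein_triangle wasserstein_nonneg in auto)

text \<open>Quantile functions along a fast subsequence converge almost everywhere to some
  \<open>g\<close>, and the limit measure is the law of \<open>g\<close>. Monotonicity of
  \<open>g\<close> is never shown: the pair of a quantile function and \<open>g\<close> is a
  coupling, and an upper bound for the distance is all that convergence requires.\<close>

lemma mcomplete_wasserstein:
  assumes p: "1 < p"
  shows "Metric_space.mcomplete (finite_moment_measures p) (wasserstein p)"
proof -
  interpret W: Metric_space "finite_moment_measures p" "wasserstein p"
    using p by (rule Metric_space_wasserstein)
  interpret U: prob_space unit_measure by (rule prob_space_unit_measure)
  show ?thesis
    unfolding W.mcomplete_def
  proof (intro allI impI)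
    fix \<sigma> assume \<sigma>: "W.MCauchy \<sigma>"
    then have fm: "\<sigma> n \<in> finite_moment_measures p" for n
      by (auto simp: W.MCauchy_def)
    note rd = fm[THEN finite_moment_real_distribution]
    have "\<exists>N. \<forall>n n'. N \<le> n \<longrightarrow> N \<le> n' \<longrightarrow> wasserstein p (\<sigma> n) (\<sigma> n') < (1/2) ^ k" for k
      using \<sigma> by (simp add: W.MCauchy_def)
    then obtain N where N: "\<And>k n n'. N k \<le> n \<Longrightarrow> N k \<le> n' \<Longrightarrow> wasserstein p (\<sigma> n) (\<sigma> n') < (1/2) ^ k"
      by metis
    \<comment> \<open>Partial sums dominate every \<open>N k\<close> and are monotone in
      \<open>k\<close>, as the indices of the subsequence must be.\<close>
    define r where "r k = (\<Sum>i\<le>k. N i)" for k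
    have r_mono: "r j \<le> r k" if "j \<le> k" for j k
      unfolding r_def using that by (intro sum_mono2) auto
    have N_le: "N k \<le> r k" for k
      unfolding r_def by (rule member_le_sum) auto
    have cost_le: "(\<integral>\<^sup>+u. ennreal (\<bar>quantile (\<sigma> n) u - quantile (\<sigma> n') u\<bar> powr p) \<partial>unit_measure)
        \<le> ennreal (((1/2) ^ k) powr p)" if "r k \<le> n" "r k \<le> n'" for k n n'
    proof -
      have "wasserstein p (\<sigma> n) (\<sigma> n') \<le> (1/2) ^ k"
        using N[of k n n'] N_le[of k] that by simp
      then have "quantile_cost p (\<sigma> n) (\<sigma> n') \<le> ((1/2) ^ k) powr p"
        using p fm by (auto simp: wasserstein_powr[symmetric] wasserstein_nonneg intro!: powr_mono2)
      then show ?thesis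
        unfolding quantile_cost_def using p fm
        by (subst nn_integral_eq_integral)
          (auto intro!: integrable_quantile_diff_powr ennreal_leI)
    qed
    define f where "f k = quantile (\<sigma> (r k))" for k
    define g where "g u = lim (\<lambda>k. f k u)" for u
    have f [measurable]: "f k \<in> borel_measurable unit_measure" for k
      unfolding f_def by (intro measurable_quantile rd)
    have g [measurable]: "g \<in> borel_measurable unit_measure"
      unfolding g_def by measurable
    have q [measurable]: "quantile (\<sigma> n) \<in> borel_measurable unit_measure" for n
      by (intro measurable_quantile rd)
    have "AE u in unit_measure. convergent (\<lambda>k. f k u)"
      unfolding f_def using p q r_mono
      by (intro AE_convergent_if_geometric_powr_diffs[where p=p] cost_le U.finite_measure_axioms) auto
    then have lim: "AE u in unit_measure. (\<lambda>k. f k u) \<longlonglongrightarrow> g u"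
      by eventually_elim (simp add: g_def convergent_LIMSEQ_iff)
    \<comment> \<open>Only the second index runs to infinity along the subsequence. The bound holds
      for all \<open>n\<close> from \<open>r k\<close> on, so the whole sequence converges.\<close>
    have g_le: "(\<integral>\<^sup>+u. ennreal (\<bar>quantile (\<sigma> n) u - g u\<bar> powr p) \<partial>unit_measure)
        \<le> ennreal (((1/2) ^ k) powr p)" if "r k \<le> n" for k n
    proof (rule nn_integral_le_of_AE_tendsto)
      show "AE u in unit_measure. (\<lambda>j. ennreal (\<bar>quantile (\<sigma> n) u - f j u\<bar> powr p))
          \<longlonglongrightarrow> ennreal (\<bar>quantile (\<sigma> n) u - g u\<bar> powr p)"
        using lim
      proof eventually_elim
        case (elim u)
        then show ?case
          using p by (intro tendsto_ennrealI tendsto_powr' tendsto_rabs tendsto_diff tendsto_const) auto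
      qed
      show "(\<integral>\<^sup>+u. ennreal (\<bar>quantile (\<sigma> n) u - f j u\<bar> powr p) \<partial>unit_measure)
          \<le> ennreal (((1/2) ^ k) powr p)" if "k \<le> j" for j
        unfolding f_def using \<open>r k \<le> n\<close> r_mono[OF that] by (rule cost_le)
    qed measurable
    define \<nu> where "\<nu> = distr unit_measure borel g"
    \<comment> \<open>The limit \<open>g\<close> inherits a finite moment as one quantile function
      minus a difference of finite cost.\<close>
    have "integrable unit_measure (\<lambda>u. \<bar>quantile (\<sigma> (r 0)) u + - (quantile (\<sigma> (r 0)) u - g u)\<bar> powr p)"
    proof (rule integrable_abs_add_powr)
      have "integrable unit_measure (\<lambda>u. \<bar>quantile (\<sigma> (r 0)) u - g u\<bar> powr p)"
        using g_le[of 0 "r 0"] by (intro integrableI_bounded) (auto simp: le_less_trans)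
      then show "integrable unit_measure (\<lambda>u. \<bar>- (quantile (\<sigma> (r 0)) u - g u)\<bar> powr p)"
        by (simp only: abs_minus_cancel)
    qed (use p fm in \<open>auto intro: integrable_quantile_powr\<close>)
    then have \<nu>: "\<nu> \<in> finite_moment_measures p"
      unfolding \<nu>_def by (intro finite_moment_distr) auto
    have le: "wasserstein p (\<sigma> n) \<nu> \<le> (1/2) ^ k" if "r k \<le> n" for k n
    proof -
      have "distr unit_measure borel (\<lambda>u. (quantile (\<sigma> n) u, g u)) \<in> couplings (\<sigma> n) \<nu>"
        using distr_Pair_in_couplings[OF q g] by (simp add: \<nu>_def distr_quantile rd)
      then have "wasserstein p (\<sigma> n) \<nu> \<le> (((1/2) ^ k) powr p) powr (1 / p)"
        using p g_le[OF that] by (intro wasserstein_le) (auto simp: cost_distr_Pair)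
      then show ?thesis
        using p by (simp add: powr_powr)
    qed
    have "limitin W.mtopology \<sigma> \<nu> sequentially"
      unfolding W.limit_metric_sequentially
    proof (intro conjI allI impI \<nu>)
      fix e :: real assume "0 < e"
      then obtain k where "(1/2) ^ k < e"
        using real_arch_pow_inv[of e "1/2"] by auto
      then show "\<exists>N. \<forall>n\<ge>N. \<sigma> n \<in> finite_moment_measures p \<and> wasserstein p (\<sigma> n) \<nu> < e"
        using le[of k] fm by (intro exI[of _ "r k"]) (auto intro: le_less_trans)
    qed
    then show "\<exists>\<nu>. limitin W.mtopology \<sigma> \<nu> sequentially" ..
  qed
qed

section \<open>Projections\<close>

lemma displacement_convexD:
  assumes "displacement_convex F" "\<rho> \<in> F" "\<rho>' \<in> F" "0 \<le> t" "t \<le> 1"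
  obtains \<eta> where "\<eta> \<in> F"
    "\<And>u. u \<in> {0<..<1} \<Longrightarrow> quantile \<eta> u = (1 - t) * quantile \<rho> u + t * quantile \<rho>' u"
proof -
  have "(\<lambda>u\<in>{0<..<1}. (1 - t) * quantile \<rho> u + t * quantile \<rho>' u) \<in> quantile ` F"
    using assms unfolding displacement_convex_def by auto
  then obtain \<eta> where \<eta>: "\<eta> \<in> F" "(\<lambda>u\<in>{0<..<1}. (1 - t) * quantile \<rho> u + t * quantile \<rho>' u) = quantile \<eta>"
    by (rule imageE)
  show ?thesis
    by (rule that[OF \<eta>(1)]) (simp add: \<eta>(2)[symmetric])
qed

text \<open>The pointwise inequality for the deviations of two quantile functions from
  \<open>quantile \<mu>\<close>, integrated. It matters that \<open>C\<close> is fixed before the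
  measures.\<close>

lemma quantile_cost_le_midpoint_gap:
  assumes p: "1 < p" and \<epsilon>: "0 < \<epsilon>"
  obtains C where "0 \<le> C"
    "\<And>\<mu> \<rho> \<rho>' \<eta>. \<lbrakk>\<mu> \<in> finite_moment_measures p; \<rho> \<in> finite_moment_measures p;
       \<rho>' \<in> finite_moment_measures p; \<eta> \<in> finite_moment_measures p;
       \<And>u. u \<in> {0<..<1} \<Longrightarrow> quantile \<eta> u = (quantile \<rho> u + quantile \<rho>' u) / 2\<rbrakk>
     \<Longrightarrow> quantile_cost p \<rho> \<rho>' \<le> \<epsilon> * (quantile_cost p \<rho> \<mu> + quantile_cost p \<rho>' \<mu>)
       + C * ((quantile_cost p \<rho> \<mu> + quantile_cost p \<rho>' \<mu>) / 2 - quantile_cost p \<eta> \<mu>)"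
proof -
  obtain C where C: "0 \<le> C"
    "\<And>a b. \<bar>a - b\<bar> powr p \<le> \<epsilon> * (\<bar>a\<bar> powr p + \<bar>b\<bar> powr p)
       + C * ((\<bar>a\<bar> powr p + \<bar>b\<bar> powr p) / 2 - \<bar>(a + b) / 2\<bar> powr p)"
    using abs_diff_powr_le_midpoint_gap[OF p \<epsilon>] by blast
  show ?thesis
  proof (rule that[OF C(1)])
    fix \<mu> \<rho> \<rho>' \<eta>
    assume fm: "\<mu> \<in> finite_moment_measures p" "\<rho> \<in> finite_moment_measures p"
      "\<rho>' \<in> finite_moment_measures p" "\<eta> \<in> finite_moment_measures p"
      and mid: "\<And>u. u \<in> {0<..<1} \<Longrightarrow> quantile \<eta> u = (quantile \<rho> u + quantile \<rho>' u) / 2"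
    let ?A = "\<lambda>u. \<bar>quantile \<rho> u - quantile \<mu> u\<bar> powr p"
    let ?B = "\<lambda>u. \<bar>quantile \<rho>' u - quantile \<mu> u\<bar> powr p"
    let ?E = "\<lambda>u. \<bar>quantile \<eta> u - quantile \<mu> u\<bar> powr p"
    have int: "integrable unit_measure ?A" "integrable unit_measure ?B" "integrable unit_measure ?E"
      "integrable unit_measure (\<lambda>u. \<bar>quantile \<rho> u - quantile \<rho>' u\<bar> powr p)"
      using p fm by (intro integrable_quantile_diff_powr; simp)+
    have "quantile_cost p \<rho> \<rho>' \<le> (\<integral>u. \<epsilon> * (?A u + ?B u) + C * ((?A u + ?B u) / 2 - ?E u) \<partial>unit_measure)"
      unfolding quantile_cost_def
    proof (rule integral_mono)
      fix u assume "u \<in> space unit_measure"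
      then have eq: "(quantile \<rho> u - quantile \<mu> u + (quantile \<rho>' u - quantile \<mu> u)) / 2
          = quantile \<eta> u - quantile \<mu> u"
        using mid[of u] by (simp add: space_restrict_space field_simps)
      then show "\<bar>quantile \<rho> u - quantile \<rho>' u\<bar> powr p
          \<le> \<epsilon> * (?A u + ?B u) + C * ((?A u + ?B u) / 2 - ?E u)"
        using C(2)[of "quantile \<rho> u - quantile \<mu> u" "quantile \<rho>' u - quantile \<mu> u", unfolded eq]
        by simp
    qed (use int in auto)
    also have "\<dots> = \<epsilon> * (quantile_cost p \<rho> \<mu> + quantile_cost p \<rho>' \<mu>)
       + C * ((quantile_cost p \<rho> \<mu> + quantile_cost p \<rho>' \<mu>) / 2 - quantile_cost p \<eta> \<mu>)"
      using int by (simp add: quantile_cost_def)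
    finally show "quantile_cost p \<rho> \<rho>' \<le> \<epsilon> * (quantile_cost p \<rho> \<mu> + quantile_cost p \<rho>' \<mu>)
       + C * ((quantile_cost p \<rho> \<mu> + quantile_cost p \<rho>' \<mu>) / 2 - quantile_cost p \<eta> \<mu>)" .
  qed
qed

text \<open>With \<open>D\<close> the infimal cost, this makes near-minimizers close to each other; it yields both
  the Cauchy property of minimizing sequences and the uniqueness of minimizers.\<close>

lemma quantile_cost_le_near_minimal:
  assumes p: "1 < p" and "F \<subseteq> finite_moment_measures p" and conv: "displacement_convex F"
    and \<mu>: "\<mu> \<in> finite_moment_measures p" and D: "0 \<le> D" "\<And>\<rho>. \<rho> \<in> F \<Longrightarrow> D \<le> quantile_cost p \<rho> \<mu>"
    and e: "0 < e"
  obtains \<delta> where "0 < \<delta>"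
    "\<And>\<rho> \<rho>'. \<rho> \<in> F \<Longrightarrow> \<rho>' \<in> F \<Longrightarrow> quantile_cost p \<rho> \<mu> \<le> D + \<delta> \<Longrightarrow> quantile_cost p \<rho>' \<mu> \<le> D + \<delta>
       \<Longrightarrow> quantile_cost p \<rho> \<rho>' < e"
proof -
  \<comment> \<open>Near-minimal costs will be at most \<open>D + 1\<close>, so the \<epsilon>-term
    contributes at most \<open>e / 2\<close>.\<close>
  define \<epsilon> where "\<epsilon> = e / (4 * (D + 1))"
  have \<epsilon>: "0 < \<epsilon>"
    using D e by (simp add: \<epsilon>_def)
  obtain C where C: "0 \<le> C"
    "\<And>\<mu> \<rho> \<rho>' \<eta>. \<lbrakk>\<mu> \<in> finite_moment_measures p; \<rho> \<in> finite_moment_measures p;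
       \<rho>' \<in> finite_moment_measures p; \<eta> \<in> finite_moment_measures p;
       \<And>u. u \<in> {0<..<1} \<Longrightarrow> quantile \<eta> u = (quantile \<rho> u + quantile \<rho>' u) / 2\<rbrakk>
     \<Longrightarrow> quantile_cost p \<rho> \<rho>' \<le> \<epsilon> * (quantile_cost p \<rho> \<mu> + quantile_cost p \<rho>' \<mu>)
       + C * ((quantile_cost p \<rho> \<mu> + quantile_cost p \<rho>' \<mu>) / 2 - quantile_cost p \<eta> \<mu>)"
    using quantile_cost_le_midpoint_gap[OF p \<epsilon>] by blast
  \<comment> \<open>The bound 1 keeps the costs below \<open>D + 1\<close>; the other bound makes
    \<open>C * \<delta>\<close> smaller than \<open>e / 2\<close>, also when
    \<open>C = 0\<close>.\<close>
  define \<delta> where "\<delta> = min 1 (e / (4 * (C + 1)))"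
  have \<delta>: "0 < \<delta>" "\<delta> \<le> 1" "C * \<delta> < e / 2"
  proof -
    show "0 < \<delta>" "\<delta> \<le> 1"
      using C e by (auto simp: \<delta>_def)
    have "C * \<delta> \<le> C * (e / (4 * (C + 1)))"
      using C by (intro mult_left_mono) (auto simp: \<delta>_def)
    also have "\<dots> < e / 2"
      using C(1) e by (simp add: field_simps add_pos_nonneg)
    finally show "C * \<delta> < e / 2" .
  qed
  show ?thesis
  proof (rule that[OF \<delta>(1)])
    fix \<rho> \<rho>'
    assume \<rho>: "\<rho> \<in> F" "\<rho>' \<in> F" "quantile_cost p \<rho> \<mu> \<le> D + \<delta>" "quantile_cost p \<rho>' \<mu> \<le> D + \<delta>"
    \<comment> \<open>The midpoint lies in \<open>F\<close>, hence costs at least \<open>D\<close>,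
      which limits the convexity gap to \<delta>.\<close>
    obtain \<eta> where \<eta>: "\<eta> \<in> F"
      "\<And>u. u \<in> {0<..<1} \<Longrightarrow> quantile \<eta> u = (1 - 1/2) * quantile \<rho> u + 1/2 * quantile \<rho>' u"
      using displacement_convexD[OF conv \<rho>(1,2), of "1/2"] by auto
    have "quantile_cost p \<rho> \<rho>' \<le> \<epsilon> * (quantile_cost p \<rho> \<mu> + quantile_cost p \<rho>' \<mu>)
       + C * ((quantile_cost p \<rho> \<mu> + quantile_cost p \<rho>' \<mu>) / 2 - quantile_cost p \<eta> \<mu>)"
      using assms(2) \<mu> \<rho> \<eta> by (intro C(2)) auto
    also have "\<dots> \<le> \<epsilon> * ((D + 1) + (D + 1)) + C * \<delta>"
    proof (intro add_mono mult_left_mono)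
      show "(quantile_cost p \<rho> \<mu> + quantile_cost p \<rho>' \<mu>) / 2 - quantile_cost p \<eta> \<mu> \<le> \<delta>"
        using \<rho>(3,4) D(2)[OF \<eta>(1)] by (simp add: field_simps)
    qed (use \<rho>(3,4) \<delta>(2) \<epsilon> C(1) in auto)
    also have "\<epsilon> * ((D + 1) + (D + 1)) = e / 2"
      using D(1) by (simp add: \<epsilon>_def field_simps)
    finally show "quantile_cost p \<rho> \<rho>' < e"
      using \<delta>(3) by simp
  qed
qed

text \<open>The direct method with completeness in place of compactness: the minimizing sequence
  itself converges, and closedness puts its limit in \<open>F\<close>.\<close>

lemma wasserstein_projection_exists:
  assumes p: "1 < p" and ne: "F \<noteq> {}" and sub: "F \<subseteq> finite_moment_measures p"
    and conv: "displacement_convex F" and closed: "closedin (wasserstein_topology p) F"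
    and \<mu>: "\<mu> \<in> finite_moment_measures p"
  shows "\<exists>\<rho>\<in>F. \<forall>\<eta>\<in>F. wasserstein p \<rho> \<mu> \<le> wasserstein p \<eta> \<mu>"
proof -
  interpret W: Metric_space "finite_moment_measures p" "wasserstein p"
    using p by (rule Metric_space_wasserstein)
  define m where "m = (INF \<eta>\<in>F. wasserstein p \<eta> \<mu>)"
  have bdd: "bdd_below ((\<lambda>\<eta>. wasserstein p \<eta> \<mu>) ` F)"
    by (auto intro!: bdd_belowI[of _ 0])
  have m_le: "m \<le> wasserstein p \<eta> \<mu>" if "\<eta> \<in> F" for \<eta>
    unfolding m_def using that bdd by (intro cINF_lower)
  have m: "0 \<le> m"
    unfolding m_def using ne by (intro cINF_greatest) auto
  have "\<exists>\<rho>\<in>F. wasserstein p \<rho> \<mu> < m + 1 / (real n + 1)" for n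
    using cINF_less_iff[OF ne bdd, of "m + 1 / (real n + 1)"] by (simp add: m_def)
  then obtain \<sigma> where \<sigma>: "\<And>n. \<sigma> n \<in> F" "\<And>n. wasserstein p (\<sigma> n) \<mu> < m + 1 / (real n + 1)"
    by metis
  have fm: "\<rho> \<in> finite_moment_measures p" if "\<rho> \<in> F" for \<rho>
    using that sub by auto
  have lim: "(\<lambda>n. wasserstein p (\<sigma> n) \<mu>) \<longlonglongrightarrow> m"
  proof (rule tendsto_sandwich[of "\<lambda>_. m" _ _ "\<lambda>n. m + 1 / (real n + 1)"])
    show "(\<lambda>n. m + 1 / (real n + 1)) \<longlonglongrightarrow> m"
      using tendsto_add[OF tendsto_const[of m] LIMSEQ_inverse_real_of_nat]
      by (simp add: inverse_eq_divide add.commute)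
  qed (use \<sigma> m_le in \<open>auto intro!: always_eventually less_imp_le\<close>)
  have "(\<lambda>n. quantile_cost p (\<sigma> n) \<mu>) \<longlonglongrightarrow> m powr p"
  proof -
    have "(\<lambda>n. wasserstein p (\<sigma> n) \<mu> powr p) \<longlonglongrightarrow> m powr p"
      using p lim by (intro tendsto_powr') (auto simp: m)
    then show ?thesis
      using p \<mu> fm \<sigma>(1) by (simp add: wasserstein_powr)
  qed
  have "W.MCauchy \<sigma>"
    unfolding W.MCauchy_def
  proof (intro conjI allI impI)
    show "range \<sigma> \<subseteq> finite_moment_measures p"
      using fm \<sigma> by auto
    fix e :: real assume e: "0 < e"
    have D: "m powr p \<le> quantile_cost p \<rho> \<mu>" if "\<rho> \<in> F" for \<rho>
      unfolding wasserstein_powr[OF p fm[OF that] \<mu>, symmetric]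
      using p m m_le[OF that] by (intro powr_mono2) auto
    obtain \<delta> where \<delta>: "0 < \<delta>"
      "\<And>\<rho> \<rho>'. \<rho> \<in> F \<Longrightarrow> \<rho>' \<in> F \<Longrightarrow> quantile_cost p \<rho> \<mu> \<le> m powr p + \<delta> \<Longrightarrow>
         quantile_cost p \<rho>' \<mu> \<le> m powr p + \<delta> \<Longrightarrow> quantile_cost p \<rho> \<rho>' < e powr p"
      using quantile_cost_le_near_minimal[OF p sub conv \<mu> _ D, of "e powr p"] e by auto
    obtain N where N: "\<And>n. N \<le> n \<Longrightarrow> quantile_cost p (\<sigma> n) \<mu> < m powr p + \<delta>"
      using order_tendstoD(2)[OF \<open>(\<lambda>n. quantile_cost p (\<sigma> n) \<mu>) \<longlonglongrightarrow> m powr p\<close>, of "m powr p + \<delta>"] \<delta>(1)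
      by (auto simp: eventually_sequentially)
    have "wasserstein p (\<sigma> n) (\<sigma> n') < e" if "N \<le> n" "N \<le> n'" for n n'
    proof -
      have "quantile_cost p (\<sigma> n) (\<sigma> n') < e powr p"
        using N that \<sigma>(1) by (intro \<delta>(2)) (auto simp: less_imp_le)
      then have "quantile_cost p (\<sigma> n) (\<sigma> n') powr (1 / p) < (e powr p) powr (1 / p)"
        using p by (intro powr_less_mono2) (auto simp: quantile_cost_nonneg)
      then show ?thesis
        using p e fm \<sigma>(1) by (simp add: wasserstein_eq_quantile_cost powr_powr)
    qed
    then show "\<exists>N. \<forall>n n'. N \<le> n \<longrightarrow> N \<le> n' \<longrightarrow> wasserstein p (\<sigma> n) (\<sigma> n') < e"
      by blast
  qed
  then obtain \<rho> where \<rho>: "limitin W.mtopology \<sigma> \<rho> sequentially"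
    using mcomplete_wasserstein[OF p] by (auto simp: W.mcomplete_def)
  have "\<rho> \<in> F"
    using closed \<rho> \<sigma>(1) unfolding W.metric_closedin_iff_sequentially_closed by blast
  \<comment> \<open>By the triangle inequality these sums bound the distance from \<rho> to \<mu>,
    so the limit attains the infimum.\<close>
  have "(\<lambda>n. wasserstein p (\<sigma> n) \<rho> + wasserstein p (\<sigma> n) \<mu>) \<longlonglongrightarrow> 0 + m"
    using \<rho> lim unfolding W.limitin_metric_dist_null by (intro tendsto_add) auto
  then have "wasserstein p \<rho> \<mu> \<le> 0 + m"
  proof (rule LIMSEQ_le_const, intro exI allI impI)
    show "wasserstein p \<rho> \<mu> \<le> wasserstein p (\<sigma> n) \<rho> + wasserstein p (\<sigma> n) \<mu>" for n
      using wasserstein_triangle[OF p fm[OF \<open>\<rho> \<in> F\<close>] fm[OF \<sigma>(1)] \<mu>] W.commute by metis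
  qed
  then show ?thesis
    using \<open>\<rho> \<in> F\<close> m_le by (auto intro: order_trans intro!: bexI[of _ \<rho>])
qed

lemma wasserstein_projection_unique:
  assumes p: "1 < p" and sub: "F \<subseteq> finite_moment_measures p"
    and conv: "displacement_convex F" and \<mu>: "\<mu> \<in> finite_moment_measures p"
    and \<rho>: "\<rho> \<in> F" "\<And>\<eta>. \<eta> \<in> F \<Longrightarrow> wasserstein p \<rho> \<mu> \<le> wasserstein p \<eta> \<mu>"
    and \<rho>': "\<rho>' \<in> F" "\<And>\<eta>. \<eta> \<in> F \<Longrightarrow> wasserstein p \<rho>' \<mu> \<le> wasserstein p \<eta> \<mu>"
  shows "\<rho> = \<rho>'"
proof -
  have fm: "\<rho> \<in> finite_moment_measures p" if "\<rho> \<in> F" for \<rho>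
    using that sub by auto
  have min: "quantile_cost p \<rho> \<mu> \<le> quantile_cost p \<eta> \<mu>" "quantile_cost p \<rho>' \<mu> \<le> quantile_cost p \<eta> \<mu>"
    if "\<eta> \<in> F" for \<eta>
    using \<rho> \<rho>' that p \<mu> fm by (simp_all add: wasserstein_le_iff_quantile_cost_le[symmetric])
  \<comment> \<open>Taking the cost of \<rho> itself as the infimal cost, both minimizers are
    near-minimal for every \<delta>, hence arbitrarily close.\<close>
  have "quantile_cost p \<rho> \<rho>' \<le> 0"
  proof (rule field_le_epsilon)
    fix e :: real assume "0 < e"
    then obtain \<delta> where \<delta>: "0 < \<delta>"
      "\<And>\<rho>1 \<rho>2. \<rho>1 \<in> F \<Longrightarrow> \<rho>2 \<in> F \<Longrightarrow> quantile_cost p \<rho>1 \<mu> \<le> quantile_cost p \<rho> \<mu> + \<delta> \<Longrightarrow>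
         quantile_cost p \<rho>2 \<mu> \<le> quantile_cost p \<rho> \<mu> + \<delta> \<Longrightarrow> quantile_cost p \<rho>1 \<rho>2 < e"
      using quantile_cost_le_near_minimal[OF p sub conv \<mu> quantile_cost_nonneg min(1)] by blast
    have "quantile_cost p \<rho> \<rho>' < e"
      using min(2)[OF \<rho>(1)] \<delta>(1) \<rho>(1) \<rho>'(1) by (intro \<delta>(2)) auto
    then show "quantile_cost p \<rho> \<rho>' \<le> 0 + e"
      by simp
  qed
  then show ?thesis
    using quantile_cost_nonneg[of p \<rho> \<rho>'] fm \<rho>(1) \<rho>'(1) by (intro eq_if_quantile_cost_eq_0[OF p]) auto
qed

section \<open>Nonexpansiveness in the Hilbert case p = 2\<close>

lemma abs_powr_2: "\<bar>x\<bar> powr 2 = x\<^sup>2" for x :: real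
  by (cases "x = 0") (auto simp: powr_numeral)

lemma quantile_cost_2: "quantile_cost 2 \<mu> \<nu> = (\<integral>u. (quantile \<mu> u - quantile \<nu> u)\<^sup>2 \<partial>unit_measure)"
  by (simp add: quantile_cost_def abs_powr_2)

lemma integrable_mult_of_squares:
  fixes f g :: "'a \<Rightarrow> real"
  assumes [measurable]: "f \<in> borel_measurable M" "g \<in> borel_measurable M"
    and "integrable M (\<lambda>x. (f x)\<^sup>2)" "integrable M (\<lambda>x. (g x)\<^sup>2)"
  shows "integrable M (\<lambda>x. f x * g x)"
proof (rule Bochner_Integration.integrable_bound)
  show "integrable M (\<lambda>x. (f x)\<^sup>2 + (g x)\<^sup>2)"
    using assms by simp
  show "AE x in M. norm (f x * g x) \<le> norm ((f x)\<^sup>2 + (g x)\<^sup>2)"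
  proof (rule AE_I2)
    fix x
    have "0 \<le> (\<bar>f x\<bar> - \<bar>g x\<bar>)\<^sup>2"
      by simp
    then have "2 * (\<bar>f x\<bar> * \<bar>g x\<bar>) \<le> (f x)\<^sup>2 + (g x)\<^sup>2"
      by (simp add: power2_diff)
    moreover have "0 \<le> \<bar>f x\<bar> * \<bar>g x\<bar>"
      by simp
    ultimately have "\<bar>f x\<bar> * \<bar>g x\<bar> \<le> (f x)\<^sup>2 + (g x)\<^sup>2"
      by linarith
    then show "norm (f x * g x) \<le> norm ((f x)\<^sup>2 + (g x)\<^sup>2)"
      by (simp add: abs_mult)
  qed
qed measurable

lemma integrable_quantile_diff_mult:
  assumes "\<mu> \<in> finite_moment_measures 2" "\<nu> \<in> finite_moment_measures 2"
    "\<mu>' \<in> finite_moment_measures 2" "\<nu>' \<in> finite_moment_measures 2"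
  shows "integrable unit_measure
    (\<lambda>u. (quantile \<mu> u - quantile \<nu> u) * (quantile \<mu>' u - quantile \<nu>' u))"
proof -
  note [measurable] = assms[THEN finite_moment_real_distribution, THEN measurable_quantile]
  show ?thesis
    using integrable_quantile_diff_powr[of 2 \<mu> \<nu>] integrable_quantile_diff_powr[of 2 \<mu>' \<nu>'] assms
    by (intro integrable_mult_of_squares) (auto simp: abs_powr_2)
qed

text \<open>First variation: moving from \<rho> towards \<eta> by a fraction \<open>t\<close>
  changes the cost by \<open>t\<^sup>2 * ?J - 2 * t * ?I\<close>, which would be negative for small
  \<open>t\<close> if \<open>?I\<close> were positive.\<close>

lemma wasserstein_2_projection_obtuse:
  assumes sub: "F \<subseteq> finite_moment_measures 2"
    and conv: "displacement_convex F" and \<mu>: "\<mu> \<in> finite_moment_measures 2"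
    and \<rho>: "\<rho> \<in> F" "\<And>\<eta>. \<eta> \<in> F \<Longrightarrow> wasserstein 2 \<rho> \<mu> \<le> wasserstein 2 \<eta> \<mu>" and \<eta>: "\<eta> \<in> F"
  shows "(\<integral>u. (quantile \<mu> u - quantile \<rho> u) * (quantile \<eta> u - quantile \<rho> u) \<partial>unit_measure) \<le> 0"
    (is "?I \<le> 0")
proof (rule ccontr)
  assume "\<not> ?I \<le> 0"
  then have I: "0 < ?I" by simp
  have fm: "\<rho> \<in> finite_moment_measures 2" if "\<rho> \<in> F" for \<rho>
    using that sub by auto
  let ?J = "quantile_cost 2 \<eta> \<rho>"
  have J: "0 \<le> ?J"
    by (rule quantile_cost_nonneg)
  \<comment> \<open>The bound 1 keeps the point on the segment; the quotient gives
    \<open>t * ?J \<le> ?I < 2 * ?I\<close>, its summand 1 covering \<open>?J = 0\<close>.\<close>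
  define t where "t = min 1 (?I / (?J + 1))"
  have t: "0 < t" "t \<le> 1" "t * ?J < 2 * ?I"
  proof -
    show "0 < t" "t \<le> 1"
      using I J by (auto simp: t_def)
    have "t * ?J \<le> ?I / (?J + 1) * ?J"
      using J by (intro mult_right_mono) (auto simp: t_def)
    also have "\<dots> \<le> ?I"
      using I J by (simp add: field_simps)
    finally show "t * ?J < 2 * ?I"
      using I by simp
  qed
  obtain \<zeta> where \<zeta>: "\<zeta> \<in> F"
    "\<And>u. u \<in> {0<..<1} \<Longrightarrow> quantile \<zeta> u = (1 - t) * quantile \<rho> u + t * quantile \<eta> u"
    using displacement_convexD[OF conv \<rho>(1) \<eta>, of t] t by auto
  have int: "integrable unit_measure (\<lambda>u. (quantile \<rho> u - quantile \<mu> u)\<^sup>2)"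
    "integrable unit_measure (\<lambda>u. (quantile \<eta> u - quantile \<rho> u)\<^sup>2)"
    "integrable unit_measure (\<lambda>u. (quantile \<mu> u - quantile \<rho> u) * (quantile \<eta> u - quantile \<rho> u))"
    unfolding power2_eq_square using fm \<rho>(1) \<eta> \<mu> by (intro integrable_quantile_diff_mult; simp)+
  have "quantile_cost 2 \<rho> \<mu> \<le> quantile_cost 2 \<zeta> \<mu>"
    using \<rho>(2)[OF \<zeta>(1)] fm \<rho>(1) \<zeta>(1) \<mu> by (simp add: wasserstein_le_iff_quantile_cost_le)
  also have "quantile_cost 2 \<zeta> \<mu> = (\<integral>u. (quantile \<rho> u - quantile \<mu> u)\<^sup>2
      - 2 * t * ((quantile \<mu> u - quantile \<rho> u) * (quantile \<eta> u - quantile \<rho> u))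
      + t\<^sup>2 * (quantile \<eta> u - quantile \<rho> u)\<^sup>2 \<partial>unit_measure)"
    unfolding quantile_cost_2
    by (intro Bochner_Integration.integral_cong refl)
      (simp add: space_restrict_space \<zeta>(2) power2_eq_square algebra_simps)
  also have "\<dots> = quantile_cost 2 \<rho> \<mu> - 2 * t * ?I + t\<^sup>2 * ?J"
    using int by (simp add: quantile_cost_2)
  finally have "t * (2 * ?I) \<le> t * (t * ?J)"
    by (simp add: power2_eq_square algebra_simps)
  with t show False
    by simp
qed

text \<open>The two obtuse-angle inequalities, each tested with the other projection, are
  added.\<close>

lemma wasserstein_2_projection_nonexpansive:
  assumes sub: "F \<subseteq> finite_moment_measures 2" and conv: "displacement_convex F"
    and \<mu>: "\<mu> \<in> finite_moment_measures 2" and \<nu>: "\<nu> \<in> finite_moment_measures 2"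
    and \<rho>: "\<rho> \<in> F" "\<And>\<eta>. \<eta> \<in> F \<Longrightarrow> wasserstein 2 \<rho> \<mu> \<le> wasserstein 2 \<eta> \<mu>"
    and \<eta>: "\<eta> \<in> F" "\<And>\<zeta>. \<zeta> \<in> F \<Longrightarrow> wasserstein 2 \<eta> \<nu> \<le> wasserstein 2 \<zeta> \<nu>"
  shows "wasserstein 2 \<rho> \<eta> \<le> wasserstein 2 \<mu> \<nu>"
proof -
  have fm: "\<rho> \<in> finite_moment_measures 2" "\<eta> \<in> finite_moment_measures 2"
    using \<rho>(1) \<eta>(1) sub by auto
  let ?f = "quantile \<mu>" and ?g = "quantile \<nu>" and ?P = "quantile \<rho>" and ?R = "quantile \<eta>"
  have int: "integrable unit_measure (\<lambda>u. (?P u - ?R u)\<^sup>2)"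
    "integrable unit_measure (\<lambda>u. (?f u - ?g u)\<^sup>2)"
    "integrable unit_measure (\<lambda>u. (?f u - ?P u) * (?R u - ?P u))"
    "integrable unit_measure (\<lambda>u. (?g u - ?R u) * (?P u - ?R u))"
    unfolding power2_eq_square using fm \<mu> \<nu> by (intro integrable_quantile_diff_mult; simp)+
  have "quantile_cost 2 \<rho> \<eta> \<le> (\<integral>u. (?f u - ?g u)\<^sup>2 + 2 * ((?f u - ?P u) * (?R u - ?P u))
      + 2 * ((?g u - ?R u) * (?P u - ?R u)) \<partial>unit_measure)"
    unfolding quantile_cost_2
  proof (rule integral_mono)
    fix u
    \<comment> \<open>This square is exactly the difference of the two sides below; it takes the
      place of Cauchy-Schwarz.\<close>
    have "0 \<le> ((?f u - ?g u) - (?P u - ?R u))\<^sup>2"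
      by simp
    then show "(?P u - ?R u)\<^sup>2 \<le> (?f u - ?g u)\<^sup>2 + 2 * ((?f u - ?P u) * (?R u - ?P u))
      + 2 * ((?g u - ?R u) * (?P u - ?R u))"
      by (simp add: power2_eq_square algebra_simps)
  qed (use int in auto)
  also have "\<dots> = quantile_cost 2 \<mu> \<nu>
      + 2 * (\<integral>u. (?f u - ?P u) * (?R u - ?P u) \<partial>unit_measure)
      + 2 * (\<integral>u. (?g u - ?R u) * (?P u - ?R u) \<partial>unit_measure)"
    using int by (simp add: quantile_cost_2)
  also have "\<dots> \<le> quantile_cost 2 \<mu> \<nu>"
    using wasserstein_2_projection_obtuse[OF sub conv \<mu> \<rho> \<eta>(1)]
      wasserstein_2_projection_obtuse[OF sub conv \<nu> \<eta> \<rho>(1)] by simp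
  finally show ?thesis
    using fm \<mu> \<nu> by (simp add: wasserstein_le_iff_quantile_cost_le)
qed

theorem theorem2p8:
  fixes p :: real and F :: "real measure set"
  assumes "1 < p"
    and "F \<noteq> {}"
    and "F \<subseteq> finite_moment_measures p"
    and "displacement_convex F"
    and "closedin (wasserstein_topology p) F"
  shows "\<exists>proj. proj \<in> finite_moment_measures p \<rightarrow> F \<and>
           (\<forall>\<mu>\<in>finite_moment_measures p. \<forall>\<nu>.
              is_arg_min (\<lambda>\<rho>. wasserstein p \<rho> \<mu>) (\<lambda>\<rho>. \<rho> \<in> F) \<nu> \<longleftrightarrow> \<nu> = proj \<mu>) \<and>
           (p = 2 \<longrightarrow>
              (\<forall>\<mu>\<in>finite_moment_measures 2. \<forall>\<nu>\<in>finite_moment_measures 2.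
                 wasserstein 2 (proj \<mu>) (proj \<nu>) \<le> wasserstein 2 \<mu> \<nu>))"
proof -
  \<comment> \<open>A choice of minimizers, unconstrained outside the moment class. Uniqueness then
    identifies every minimizer with the chosen one.\<close>
  obtain proj where proj: "\<And>\<mu>. \<mu> \<in> finite_moment_measures p \<Longrightarrow> proj \<mu> \<in> F"
    "\<And>\<mu> \<eta>. \<mu> \<in> finite_moment_measures p \<Longrightarrow> \<eta> \<in> F \<Longrightarrow> wasserstein p (proj \<mu>) \<mu> \<le> wasserstein p \<eta> \<mu>"
    using wasserstein_projection_exists[OF assms] by metis
  show ?thesis
  proof (intro exI[of _ proj] conjI ballI allI impI)
    show "proj \<in> finite_moment_measures p \<rightarrow> F"
      using proj(1) by blast
    show "is_arg_min (\<lambda>\<rho>. wasserstein p \<rho> \<mu>) (\<lambda>\<rho>. \<rho> \<in> F) \<nu> \<longleftrightarrow> \<nu> = proj \<mu>"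
      if \<mu>: "\<mu> \<in> finite_moment_measures p" for \<mu> \<nu>
    proof
      assume "is_arg_min (\<lambda>\<rho>. wasserstein p \<rho> \<mu>) (\<lambda>\<rho>. \<rho> \<in> F) \<nu>"
      then show "\<nu> = proj \<mu>"
        using assms \<mu> proj
        by (intro wasserstein_projection_unique[of p F \<mu>]) (auto simp: is_arg_min_def not_less)
    next
      assume "\<nu> = proj \<mu>"
      then show "is_arg_min (\<lambda>\<rho>. wasserstein p \<rho> \<mu>) (\<lambda>\<rho>. \<rho> \<in> F) \<nu>"
        using proj \<mu> by (auto simp: is_arg_min_def not_less)
    qed
    show "wasserstein 2 (proj \<mu>) (proj \<nu>) \<le> wasserstein 2 \<mu> \<nu>"
      if "p = 2" "\<mu> \<in> finite_moment_measures 2" "\<nu> \<in> finite_moment_measures 2" for \<mu> \<nu>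
    proof (rule wasserstein_2_projection_nonexpansive)
      show "F \<subseteq> finite_moment_measures 2" "displacement_convex F"
        using assms(3,4) \<open>p = 2\<close> by simp_all
      show "proj \<mu> \<in> F" "proj \<nu> \<in> F"
        using proj(1) that by simp_all
      show "wasserstein 2 (proj \<mu>) \<mu> \<le> wasserstein 2 \<eta> \<mu>" "wasserstein 2 (proj \<nu>) \<nu> \<le> wasserstein 2 \<eta> \<nu>"
        if "\<eta> \<in> F" for \<eta>
        using proj(2)[OF _ that] \<open>p = 2\<close> \<open>\<mu> \<in> _\<close> \<open>\<nu> \<in> _\<close> by blast+
    qed (fact that)+
  qed
qed

end
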